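(* Let $f\not\equiv0$ be a meromorphic function on $\mathbb{C}$ of finite order $\sigma$ and let $\eta$ be a non-zero complex number. Then for each $\varepsilon>0$, $$m\Big(r,\frac{f(z+\eta)}{f(z)}\Big)+m\Big(r,\frac{f(z)}{f(z+\eta)}\Big)=O(r^{\sigma-1+\varepsilon})\qquad (r\to\infty).$$
   Context: Meromorphic means meromorphic in the whole complex plane. For meromorphic $g$: $m(r,g)=\frac1{2\pi}\int_0^{2\pi}\log^+|g(re^{i\theta})|\,d\theta$; $n(t,g)$ is the number of poles of $g$ in $|z|\le t$, with multiplicity; $N(r,g)=\int_0^r\frac{n(t,g)-n(0,g)}{t}\,dt+n(0,g)\log r$; $T(r,g)=m(r,g)+N(r,g)$. The order of $g$ is $\limsup_{r\to\infty}\frac{\log^+T(r,g)}{\log r}$. *)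

theory Defs
  imports "HOL-Complex_Analysis.Complex_Analysis" "HOL-Library.Landau_Symbols"
begin

text \<open>
  With the library notion \<open>f meromorphic_on A\<close>, the function may take arbitrary values on a sparse set of
  points. All notions below are insensitive to this: \<^term>\<open>is_pole\<close> and \<^term>\<open>zorder\<close> only
  depend on punctured neighbourhoods, and a circle contains only finitely many such points.
\<close>

text \<open>The usual truncation \<open>max 0 (ln x)\<close>, with the convention that it is 0 at \<open>x = 0\<close>.\<close>

definition log_plus :: "real \<Rightarrow> real" where
  "log_plus x = ln (max 1 x)"

definition proximity :: "real \<Rightarrow> (complex \<Rightarrow> complex) \<Rightarrow> real" where
  "proximity r g =
     1 / (2 * pi) * integral {0..2*pi} (\<lambda>\<theta>. log_plus (norm (g (of_real r * cis \<theta>))))"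

definition pole_count :: "real \<Rightarrow> (complex \<Rightarrow> complex) \<Rightarrow> nat" where
  "pole_count t g = (\<Sum>z | is_pole g z \<and> norm z \<le> t. nat (- zorder g z))"

definition pole_counting :: "real \<Rightarrow> (complex \<Rightarrow> complex) \<Rightarrow> real" where
  "pole_counting r g =
     integral {0..r} (\<lambda>t. (real (pole_count t g) - real (pole_count 0 g)) / t)
       + real (pole_count 0 g) * ln r"

definition nevanlinna_char :: "real \<Rightarrow> (complex \<Rightarrow> complex) \<Rightarrow> real" where
  "nevanlinna_char r g = proximity r g + pole_counting r g"

definition meromorphic_order :: "(complex \<Rightarrow> complex) \<Rightarrow> ereal" where
  "meromorphic_order g = Limsup at_top (\<lambda>r::real. ereal (log_plus (nevanlinna_char r g) / ln r))"

end

theory Submission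
  imports Defs
begin

text \<open>
  On the disc of radius \<open>R\<close>, write \<open>f\<close> as a product of factors \<open>((z - p) / R) powi zorder f p\<close> over its
  zeros and poles times \<open>exp h\<close> with \<open>h\<close> holomorphic. Comparing means of logarithms over the circle
  gives Jensen's formula, so that \<open>m(R, 1/f)\<close> and the number of zeros and poles are controlled by the
  characteristic \<open>T\<close>, that is, by \<open>r powr (\<sigma> + \<epsilon>/2)\<close> for \<open>R\<close> comparable to \<open>r\<close>. The logarithm of
  \<open>\<bar>f (z + \<eta>) / f z\<bar>\<close> then splits in two parts. The change of \<open>Re h\<close> is at most \<open>\<bar>\<eta>\<bar> sup \<bar>h'\<bar>\<close>, and
  \<open>h'\<close> is bounded on the half disc by \<open>1/R\<close> times the mean of \<open>\<bar>Re h\<bar>\<close>. Each zero or pole \<open>p\<close>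
  contributes at most a constant times \<open>\<bar>z - p\<bar> powr - \<delta> + \<bar>z + \<eta> - p\<bar> powr - \<delta>\<close>, whose mean over
  \<open>\<bar>z\<bar> = r\<close> is \<open>O(r powr - \<delta>)\<close> uniformly in \<open>p\<close>, for any \<open>\<delta> < 1\<close>.
\<close>

subsection \<open>A singular kernel on circles\<close>

text \<open>For \<open>x \<le> 1\<close> the bound passes through
  \<open>x \<le> x powr \<delta>\<close>; for larger \<open>x\<close> it combines
  \<open>ln y \<le> y powr \<delta> / \<delta>\<close> with \<open>1 + x \<le> 2 * x\<close>. It
  replaces logarithms by powers, whose circle means decay like
  \<open>r powr - \<delta>\<close>.\<close>

lemma ln_one_plus_le_powr:
  fixes x \<delta> :: real
  assumes "0 \<le> x" "0 < \<delta>" "\<delta> \<le> 1"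
  shows "ln (1 + x) \<le> 2 / \<delta> * x powr \<delta>"
proof (cases "x \<le> 1")
  case True
  have "ln (1 + x) \<le> x" using assms by (intro ln_add_one_self_le_self)
  also have "x \<le> x powr \<delta>"
    using powr_mono'[of \<delta> 1 x] assms True by simp
  also have "\<dots> \<le> 2 / \<delta> * x powr \<delta>"
    using mult_right_mono[of 1 "2 / \<delta>" "x powr \<delta>"] assms by (simp add: field_simps)
  finally show ?thesis .
next
  case False
  have "ln (1 + x) \<le> (1 + x) powr \<delta> / \<delta>"
    using assms by (intro ln_powr_bound) auto
  also have "(1 + x) powr \<delta> \<le> (2 * x) powr \<delta>"
    using assms False by (intro powr_mono2) auto
  also have "(2 * x) powr \<delta> \<le> 2 * x powr \<delta>"
    using assms powr_mono[of \<delta> 1 "2::real"] by (simp add: powr_mult mult_right_mono)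
  finally show ?thesis using assms by (simp add: divide_right_mono)
qed

text \<open>With \<open>x\<close> half of \<open>\<bar>y\<bar>\<close>, monotonicity of
  \<open>sin u - u * cos u\<close> gives \<open>x * cos x \<le> sin x\<close>. Doubling the angle
  leaves the factor \<open>2 * (cos x)\<^sup>2\<close>, which is at least 1 because
  \<open>2 * x \<le> pi / 2\<close>.\<close>

lemma abs_sin_ge_half:
  fixes y :: real
  assumes "\<bar>y\<bar> \<le> pi / 2"
  shows "\<bar>y\<bar> / 2 \<le> \<bar>sin y\<bar>"
proof -
  have *: "x * cos x \<le> sin x" if "0 \<le> x" "x \<le> pi / 2" for x :: real
  proof -
    have "sin 0 - 0 * cos 0 \<le> sin x - x * cos x"
    proof (rule DERIV_nonneg_imp_nondecreasing[OF \<open>0 \<le> x\<close>])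
      fix u assume u: "0 \<le> u" "u \<le> x"
      have "((\<lambda>u. sin u - u * cos u) has_real_derivative u * sin u) (at u)"
        by (auto intro!: derivative_eq_intros)
      moreover have "0 \<le> u * sin u" using u that by (intro mult_nonneg_nonneg sin_ge_zero) auto
      ultimately show "\<exists>d. ((\<lambda>u. sin u - u * cos u) has_real_derivative d) (at u) \<and> 0 \<le> d" by blast
    qed
    then show ?thesis by simp
  qed
  define x where "x = \<bar>y\<bar> / 2"
  have x: "0 \<le> x" "x \<le> pi / 4" using assms by (auto simp: x_def)
  have c0: "0 \<le> cos (2 * x)" using x by (intro cos_ge_zero) auto
  have c1: "0 \<le> cos x" using x pi_gt_zero by (intro cos_ge_zero) (auto simp del: pi_gt_zero)
  have c: "1 / 2 \<le> (cos x)\<^sup>2" using c0 cos_double_cos[of x] by simp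
  have "x \<le> 2 * x * (cos x)\<^sup>2" using c x mult_left_mono[OF c, of "2 * x"] by simp
  also have "\<dots> = 2 * (x * cos x) * cos x" by (simp add: power2_eq_square)
  also have "\<dots> \<le> 2 * sin x * cos x" using *[of x] x c1 by (intro mult_right_mono) auto
  also have "\<dots> = sin (2 * x)" by (simp add: sin_double)
  also have "\<dots> \<le> \<bar>sin y\<bar>" by (auto simp: x_def abs_if)
  finally show ?thesis by (simp add: x_def)
qed

text \<open>The distance to \<open>p\<close> is at least the distance to the line through \<open>0\<close> and \<open>p\<close>.\<close>

lemma norm_rcis_diff_ge:
  "norm (of_real r * cis \<theta> - p) \<ge> r * \<bar>sin (\<theta> - Arg p)\<bar>" if "r \<ge> 0"
proof -
  have p: "p = of_real (norm p) * cis (Arg p)"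
    using rcis_cmod_Arg[of p] by (simp add: rcis_def)
  have "norm (of_real r * cis \<theta> - p) = norm ((of_real r * cis \<theta> - p) * cis (- Arg p))"
    by (simp add: norm_mult)
  also have "(of_real r * cis \<theta> - p) * cis (- Arg p) = of_real r * (cis \<theta> * cis (- Arg p)) - p * cis (- Arg p)"
    by (simp add: algebra_simps)
  also have "p * cis (- Arg p) = of_real (norm p)"
    using p by (metis add.right_inverse cis_mult cis_zero mult.assoc mult.right_neutral)
  also have "cis \<theta> * cis (- Arg p) = cis (\<theta> - Arg p)"
    by (simp add: cis_mult)
  finally have "norm (of_real r * cis \<theta> - p) = norm (of_real r * cis (\<theta> - Arg p) - of_real (norm p))" .
  also have "\<dots> \<ge> \<bar>Im (of_real r * cis (\<theta> - Arg p) - of_real (norm p))\<bar>" by (rule abs_Im_le_cmod)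
  finally show ?thesis using that by (simp add: abs_mult)
qed

text \<open>The odd antiderivative \<open>F\<close> is continuous across the singularity because
  \<open>1 - \<delta> > 0\<close>, so the fundamental theorem applies with \<open>c\<close> as
  exceptional point.\<close>

lemma has_integral_abs_powr:
  fixes c \<delta> a b :: real
  assumes "\<delta> < 1" "a \<le> b"
  shows "((\<lambda>t. \<bar>t - c\<bar> powr - \<delta>) has_integral
     (sgn (b - c) * \<bar>b - c\<bar> powr (1 - \<delta>) - sgn (a - c) * \<bar>a - c\<bar> powr (1 - \<delta>)) / (1 - \<delta>)) {a..b}"
proof -
  have D: "((\<lambda>u. u powr (1 - \<delta>) / (1 - \<delta>)) has_real_derivative u powr - \<delta>) (at u)" if "u > 0" for u
    using DERIV_cdivide[OF has_real_derivative_powr[OF that, of "1 - \<delta>"], of "1 - \<delta>"] assms by simp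
  define F where "F = (\<lambda>t. sgn (t - c) * \<bar>t - c\<bar> powr (1 - \<delta>) / (1 - \<delta>))"
  have "((\<lambda>t. \<bar>t - c\<bar> powr - \<delta>) has_integral F b - F a) {a..b}"
  proof (rule fundamental_theorem_of_calculus_interior_strong[of "{c}"])
    fix t assume t: "t \<in> {a<..<b} - {c}"
    show "(F has_vector_derivative \<bar>t - c\<bar> powr - \<delta>) (at t)"
      unfolding has_real_derivative_iff_has_vector_derivative[symmetric]
    proof (cases "t > c")
      case True
      have "((\<lambda>t. (t - c) powr (1 - \<delta>) / (1 - \<delta>)) has_real_derivative \<bar>t - c\<bar> powr - \<delta>) (at t)"
        using DERIV_chain2[OF D, of "\<lambda>t. t - c" t 1 UNIV] True assms by (auto intro!: derivative_eq_intros)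
      then show "(F has_real_derivative \<bar>t - c\<bar> powr - \<delta>) (at t)"
      proof (rule has_field_derivative_transform_within_open[where S = "{c<..}"])
        fix x assume "x \<in> {c<..}"
        then show "(x - c) powr (1 - \<delta>) / (1 - \<delta>) = F x" by (simp add: F_def)
      qed (use True in auto)
    next
      case False
      have "((\<lambda>t. - ((c - t) powr (1 - \<delta>) / (1 - \<delta>))) has_real_derivative \<bar>t - c\<bar> powr - \<delta>) (at t)"
        using DERIV_minus[OF DERIV_chain2[OF D, of "\<lambda>t. c - t" t "-1" UNIV]] False t assms
        by (auto intro!: derivative_eq_intros simp: abs_if)
      then show "(F has_real_derivative \<bar>t - c\<bar> powr - \<delta>) (at t)"
      proof (rule has_field_derivative_transform_within_open[where S = "{..<c}"])
        fix x assume "x \<in> {..<c}"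
        then show "- ((c - x) powr (1 - \<delta>) / (1 - \<delta>)) = F x" by (simp add: F_def)
      qed (use False t in auto)
    qed
  next
    \<comment> \<open>Without \<open>sgn\<close>, \<open>F\<close> is glued from two continuous
      branches that both vanish at \<open>c\<close>.\<close>
    have eq: "F = (\<lambda>t. if t \<le> c then - (\<bar>t - c\<bar> powr (1 - \<delta>) / (1 - \<delta>)) else \<bar>t - c\<bar> powr (1 - \<delta>) / (1 - \<delta>))"
      by (auto simp: F_def fun_eq_iff sgn_if)
    have cont: "continuous_on X (\<lambda>t. \<bar>t - c\<bar> powr (1 - \<delta>))" for X
      using assms by (intro continuous_intros continuous_on_powr') auto
    have "continuous_on ({a..b} \<inter> {..c} \<union> {a..b} \<inter> {c..}) F"
      unfolding eq using assms
      by (intro continuous_on_cases_le continuous_on_divide continuous_on_minus cont) auto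
    moreover have "{a..b} \<inter> {..c} \<union> {a..b} \<inter> {c..} = {a..b}" by auto
    ultimately show "continuous_on {a..b} F" by simp
  qed (use assms in auto)
  then show ?thesis by (simp add: F_def diff_divide_distrib)
qed

text \<open>The distance to \<open>p\<close> is at least \<open>r / 2\<close> times the distance of
  the angle to the nearest zero of \<open>sin (t - Arg p)\<close>. Five translates of a
  one-dimensional kernel therefore dominate, and neither their number nor their integrals depend on
  the modulus of \<open>p\<close>; this makes \<open>C\<close> uniform.\<close>

lemma circle_kernel:
  fixes \<delta> :: real
  assumes "0 < \<delta>" "\<delta> < 1"
  obtains C where "C > 0"
    "\<And>r p. r > 0 \<Longrightarrow> (\<lambda>\<theta>. norm (of_real r * cis \<theta> - p) powr - \<delta>) integrable_on {0..2*pi}"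
    "\<And>r p. r > 0 \<Longrightarrow> integral {0..2*pi} (\<lambda>\<theta>. norm (of_real r * cis \<theta> - p) powr - \<delta>) \<le> C * r powr - \<delta>"
proof -
  \<comment> \<open>\<open>M\<close> bounds the integral of one translate: \<open>10 * pi\<close>
    generously exceeds the distance from any \<open>c k\<close> to both endpoints. In
    \<open>C\<close>, the 5 counts the translates and \<open>2 powr \<delta>\<close> comes from
    \<open>(r / 2) powr - \<delta>\<close>.\<close>
  define M where "M = 2 * (10 * pi) powr (1 - \<delta>) / (1 - \<delta>)"
  have M: "M > 0" using assms by (auto simp: M_def intro!: divide_pos_pos)
  define C where "C = 2 powr \<delta> * (5 * M)"
  have key: "(\<lambda>\<theta>. norm (of_real r * cis \<theta> - p) powr - \<delta>) integrable_on {0..2*pi} \<and>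
     integral {0..2*pi} (\<lambda>\<theta>. norm (of_real r * cis \<theta> - p) powr - \<delta>) \<le> C * r powr - \<delta>"
    (is "?f integrable_on _ \<and> _") if r: "r > 0" for r p
  proof -
    define \<phi> where "\<phi> = Arg p"
    have \<phi>: "-pi < \<phi>" "\<phi> \<le> pi" unfolding \<phi>_def using Arg_bounded[of p] by auto
    \<comment> \<open>the translates \<open>c k\<close>, \<open>k \<in> K\<close>, include the zero of \<open>sin (t - \<phi>)\<close> nearest to each \<open>t \<in> {0..2*pi}\<close>\<close>
    define K where "K = {-1..3::int}"
    define c where "c = (\<lambda>k::int. \<phi> + of_int k * pi)"
    define G where "G = (\<lambda>t. \<Sum>k\<in>K. (r / 2) powr - \<delta> * \<bar>t - c k\<bar> powr - \<delta>)"
    \<comment> \<open>At \<open>t = c k\<close> the singular summand of \<open>G\<close> is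
      \<open>0\<close> by the convention for \<open>0 powr - \<delta>\<close>, so \<open>G\<close>
      may fail to dominate there. Redefining it on a finite set leaves the integral
      unchanged.\<close>
    define H where "H = (\<lambda>t. if t \<in> c ` K then ?f t else G t)"
    have Gk: "(\<lambda>t. \<bar>t - c k\<bar> powr - \<delta>) integrable_on {0..2*pi}"
      "integral {0..2*pi} (\<lambda>t. \<bar>t - c k\<bar> powr - \<delta>) \<le> M" if "k \<in> K" for k
    proof -
      have *: "\<bar>s\<bar> powr (1 - \<delta>) \<le> (10 * pi) powr (1 - \<delta>)" if "\<bar>s\<bar> \<le> 10 * pi" for s :: real
        using that assms by (intro powr_mono2) auto
      define \<kappa> where "\<kappa> = of_int k * pi"
      have k: "\<kappa> \<ge> (-1) * pi" "\<kappa> \<le> 3 * pi"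
        unfolding \<kappa>_def using that by (intro mult_right_mono; simp add: K_def)+
      have 1: "\<bar>2 * pi - c k\<bar> powr (1 - \<delta>) \<le> (10 * pi) powr (1 - \<delta>)"
        and 2: "\<bar>0 - c k\<bar> powr (1 - \<delta>) \<le> (10 * pi) powr (1 - \<delta>)"
        by (rule *, use \<phi> k in \<open>simp add: c_def \<kappa>_def[symmetric] abs_if\<close>)+
      have sg: "sgn a * u \<le> B" "- (sgn a * u) \<le> B" if "0 \<le> u" "u \<le> B" for a u B :: real
        using that by (auto simp: sgn_if)
      note I = has_integral_abs_powr[OF \<open>\<delta> < 1\<close>, of 0 "2 * pi" "c k"]
      show "(\<lambda>t. \<bar>t - c k\<bar> powr - \<delta>) integrable_on {0..2*pi}"
        using I by (auto simp: integrable_on_def)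
      have "integral {0..2*pi} (\<lambda>t. \<bar>t - c k\<bar> powr - \<delta>) =
         (sgn (2 * pi - c k) * \<bar>2 * pi - c k\<bar> powr (1 - \<delta>) - sgn (0 - c k) * \<bar>0 - c k\<bar> powr (1 - \<delta>)) / (1 - \<delta>)"
        using I by (intro integral_unique) auto
      also have "\<dots> \<le> ((10 * pi) powr (1 - \<delta>) + (10 * pi) powr (1 - \<delta>)) / (1 - \<delta>)"
        using sg(1)[OF _ 1, of "2 * pi - c k"] sg(2)[OF _ 2, of "0 - c k"] assms
        by (intro divide_right_mono) auto
      finally show "integral {0..2*pi} (\<lambda>t. \<bar>t - c k\<bar> powr - \<delta>) \<le> M" by (simp add: M_def)
    qed
    have G: "(G has_integral (\<Sum>k\<in>K. (r / 2) powr - \<delta> * integral {0..2*pi} (\<lambda>t. \<bar>t - c k\<bar> powr - \<delta>))) {0..2*pi}"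
      unfolding G_def using Gk(1)
      by (intro has_integral_sum has_integral_mult_right integrable_integral) (auto simp: K_def)
    have H: "(H has_integral (\<Sum>k\<in>K. (r / 2) powr - \<delta> * integral {0..2*pi} (\<lambda>t. \<bar>t - c k\<bar> powr - \<delta>))) {0..2*pi}"
      by (rule has_integral_spike_finite[OF _ _ G, of "c ` K"]) (auto simp: H_def K_def)
    have le: "?f t \<le> H t" if "t \<in> {0..2*pi}" for t
    proof (cases "t \<in> c ` K")
      case False
      define k where "k = round ((t - \<phi>) / pi)"
      have "\<bar>of_int k - (t - \<phi>) / pi\<bar> \<le> 1 / 2" unfolding k_def by (rule of_int_round_abs_le)
      then have "\<bar>of_int k - (t - \<phi>) / pi\<bar> * pi \<le> 1 / 2 * pi" by (intro mult_right_mono) auto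
      moreover have "\<bar>of_int k - (t - \<phi>) / pi\<bar> * pi = \<bar>t - c k\<bar>"
        using pi_gt_zero by (simp add: c_def abs_if field_simps del: pi_gt_zero)
      ultimately have near: "\<bar>t - c k\<bar> \<le> pi / 2" by simp
      define \<kappa> where "\<kappa> = of_int k * pi"
      have "\<kappa> < 4 * pi" "\<kappa> > (-2) * pi"
        using near \<phi> that pi_gt_zero by (auto simp: c_def \<kappa>_def[symmetric] abs_if split: if_splits)
      then have "real_of_int k < 4" "real_of_int k > -2"
        unfolding \<kappa>_def using pi_gt_zero mult_less_cancel_right_pos by blast+
      then have kK: "k \<in> K" by (auto simp: K_def)
      then have nz: "\<bar>t - c k\<bar> > 0" using False by auto
      have sk: "sin (of_int k * pi) = 0" unfolding sin_zero_iff_int2 by blast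
      have ck: "\<bar>cos (of_int k * pi)\<bar> = 1"
        using sin_cos_squared_add[of "of_int k * pi"] unfolding sk
        by (metis abs_square_eq_1 add_0 zero_power2)
      have "sin ((t - c k) + of_int k * pi) = sin (t - c k) * cos (of_int k * pi)"
        unfolding sin_add sk by simp
      moreover have "(t - c k) + of_int k * pi = t - \<phi>" by (simp add: c_def)
      ultimately have sin_eq: "\<bar>sin (t - \<phi>)\<bar> = \<bar>sin (t - c k)\<bar>"
        using ck by (metis abs_mult mult.right_neutral)
      have "0 < r / 2 * \<bar>t - c k\<bar>" using nz r by simp
      moreover have "r * \<bar>t - c k\<bar> / 2 \<le> r * \<bar>sin (t - \<phi>)\<bar>"
        unfolding sin_eq using mult_left_mono[OF abs_sin_ge_half[OF near], of r] r by simp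
      then have "r / 2 * \<bar>t - c k\<bar> \<le> norm (of_real r * cis t - p)"
        using norm_rcis_diff_ge[of r t p] r unfolding \<phi>_def
        by (metis less_eq_real_def order_trans times_divide_eq_left)
      ultimately have "?f t \<le> (r / 2 * \<bar>t - c k\<bar>) powr - \<delta>"
        using assms by (intro powr_mono2') auto
      also have "\<dots> = (r / 2) powr - \<delta> * \<bar>t - c k\<bar> powr - \<delta>"
        by (rule powr_mult)
      also have "\<dots> \<le> G t"
        unfolding G_def using kK by (intro member_le_sum) (auto simp: K_def)
      finally show ?thesis using False by (simp add: H_def)
    qed (simp add: H_def)
    have int: "?f integrable_on {0..2*pi}"
    proof (rule measurable_bounded_by_integrable_imp_integrable)
      have "?f \<in> borel_measurable borel"
        by (intro powr_real_measurable borel_measurable_continuous_onI continuous_intros)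
      then show "?f \<in> borel_measurable (lebesgue_on {0..2*pi})"
        by (simp add: measurable_completion measurable_restrict_space1)
    qed (use H le in \<open>auto simp: integrable_on_def\<close>)
    have "integral {0..2*pi} ?f \<le> integral {0..2*pi} H"
      using int H le by (intro integral_le) (auto simp: integrable_on_def)
    also have "\<dots> = (\<Sum>k\<in>K. (r / 2) powr - \<delta> * integral {0..2*pi} (\<lambda>t. \<bar>t - c k\<bar> powr - \<delta>))"
      using H by (rule integral_unique)
    also have "\<dots> \<le> (\<Sum>k\<in>K. (r / 2) powr - \<delta> * M)"
      using Gk(2) by (intro sum_mono mult_left_mono) auto
    also have "\<dots> = C * r powr - \<delta>"
      using r by (simp add: K_def C_def powr_divide powr_minus divide_simps)
    finally show ?thesis using int by simp
  qed
  have "C > 0" using M by (simp add: C_def)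
  with key show thesis by (intro that) auto
qed

subsection \<open>Holomorphic functions on circles\<close>

lemma norm_rcis_pos [simp]: "0 < r \<Longrightarrow> norm (of_real r * cis t) = r"
  by (simp add: norm_mult)

lemma continuous_on_circle:
  assumes "continuous_on (sphere 0 r) F" "0 < r"
  shows "continuous_on A (\<lambda>t. F (of_real r * cis t))"
  by (rule continuous_on_compose2[OF assms(1)]) (use assms in \<open>auto intro!: continuous_intros\<close>)

text \<open>Cauchy's formula at the centre: after parametrisation the denominator cancels against
  the derivative of the path, up to the factor \<open>\<i>\<close>.\<close>

lemma holomorphic_circle_mean:
  assumes "h holomorphic_on ball 0 R'" "0 < R" "R < R'"
  shows "((\<lambda>t. h (of_real R * cis t)) has_integral 2 * of_real pi * h 0) {0..2*pi}"
proof -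
  have "cball 0 R \<subseteq> ball (0::complex) R'" using assms by auto
  then have "((\<lambda>u. h u / (u - 0)) has_contour_integral 2 * of_real pi * \<i> * h 0) (circlepath 0 R)"
    using assms by (intro Cauchy_integral_circlepath)
      (auto intro: holomorphic_on_imp_continuous_on holomorphic_on_subset)
  then have "((\<lambda>t. h (0 + of_real R * cis t) / (0 + of_real R * cis t - 0) * of_real R * \<i> * cis t)
      has_integral 2 * of_real pi * \<i> * h 0) {0..2*pi}"
    by (simp only: circlepath_def has_contour_integral_part_circlepath_iff pi_gt_zero mult_pos_pos zero_less_numeral)
  from has_integral_mult_right[OF this, of "- \<i>"] show ?thesis
    using assms by (simp add: field_simps)
qed

text \<open>
  Cauchy's formula for \<open>h' z\<close> involves \<open>h\<close> rather than \<open>Re h\<close>. On the circle,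
  \<open>cnj \<zeta> = R\<^sup>2 / \<zeta>\<close>, so the same integral with \<open>cnj (h \<zeta>)\<close> in place of \<open>h \<zeta>\<close> is the conjugate of
  the circle mean of a holomorphic function \<open>k\<close> with \<open>k 0 = 0\<close>; adding it turns \<open>h\<close> into \<open>2 Re h\<close>.
\<close>

lemma deriv_bound_circle_Re:
  assumes h: "h holomorphic_on ball 0 R'" and R: "0 < R" "R < R'" and z: "norm z \<le> R / 2"
  shows "norm (deriv h z) \<le> 4 / (pi * R) * integral {0..2*pi} (\<lambda>t. \<bar>Re (h (of_real R * cis t))\<bar>)"
proof -
  define \<zeta> where "\<zeta> = (\<lambda>t. of_real R * cis t)"
  define k where "k = (\<lambda>w. h w * (of_real R ^ 2 * w / (of_real R ^ 2 - cnj z * w) ^ 2))"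
  have sub: "cball 0 R \<subseteq> ball (0::complex) R'" using R by auto
  have cont: "continuous_on (cball 0 R) h"
    using h sub by (meson holomorphic_on_imp_continuous_on holomorphic_on_subset)
  have hol: "h holomorphic_on ball 0 R"
    using h R by (auto intro: holomorphic_on_subset)
  have zb: "z \<in> ball 0 R" using z R by auto
  note D = Cauchy_derivative_integral_circlepath[OF cont hol zb]
  have "((\<lambda>u. h u / (u - z) ^ 2) has_contour_integral 2 * of_real pi * \<i> * deriv h z) (circlepath 0 R)"
    using has_contour_integral_integral[OF D(1)] DERIV_imp_deriv[OF D(2)] by simp
  then have "((\<lambda>t. h (0 + \<zeta> t) / (0 + \<zeta> t - z) ^ 2 * of_real R * \<i> * cis t)
      has_integral 2 * of_real pi * \<i> * deriv h z) {0..2*pi}"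
    unfolding \<zeta>_def by (simp only: circlepath_def
        has_contour_integral_part_circlepath_iff pi_gt_zero mult_pos_pos zero_less_numeral)
  from has_integral_mult_right[OF this, of "- \<i>"]
  have 1: "((\<lambda>t. h (\<zeta> t) * (\<zeta> t / (\<zeta> t - z) ^ 2)) has_integral 2 * of_real pi * deriv h z) {0..2*pi}"
    by (simp add: \<zeta>_def mult_ac)
  \<comment> \<open>A zero of this denominator has modulus \<open>R\<^sup>2 / norm z\<close>, at
    least \<open>2 * R\<close>; hence \<open>k\<close> is holomorphic beyond the circle.\<close>
  have ne: "of_real R ^ 2 - cnj z * w \<noteq> 0" if "w \<in> ball 0 (2 * R)" for w
  proof
    assume "of_real R ^ 2 - cnj z * w = 0"
    then have "norm (of_real R ^ 2 :: complex) = norm (cnj z * w)" by simp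
    then have "R ^ 2 = norm z * norm w" using R by (simp add: norm_mult norm_power)
    also have "\<dots> \<le> R / 2 * norm w" using z by (intro mult_right_mono) auto
    also have "\<dots> < R / 2 * (2 * R)" using that R by (intro mult_strict_left_mono) auto
    finally show False by (simp add: power2_eq_square)
  qed
  have "k holomorphic_on ball 0 (min R' (2 * R))"
    unfolding k_def using ne by (intro holomorphic_intros holomorphic_on_subset[OF h]) auto
  then have "((\<lambda>t. k (\<zeta> t)) has_integral 2 * of_real pi * k 0) {0..2*pi}"
    unfolding \<zeta>_def using R by (intro holomorphic_circle_mean[where R' = "min R' (2 * R)"]) auto
  then have "((\<lambda>t. k (\<zeta> t)) has_integral 0) {0..2*pi}" by (simp add: k_def)
  then have "((\<lambda>t. cnj (k (\<zeta> t))) has_integral cnj 0) {0..2*pi}"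
    by (simp only: has_integral_cnj[unfolded o_def])
  moreover have "cnj (k (\<zeta> t)) = cnj (h (\<zeta> t)) * (\<zeta> t / (\<zeta> t - z) ^ 2)" for t
  proof -
    have nz: "\<zeta> t \<noteq> 0" "\<zeta> t \<noteq> z" using z R by (auto simp: \<zeta>_def norm_mult dest: arg_cong[of _ _ norm])
    have c: "cnj (\<zeta> t) = of_real R ^ 2 / \<zeta> t"
      using R by (simp add: \<zeta>_def cis_cnj cis_inverse power2_eq_square divide_inverse)
    have "of_real R ^ 2 - z * (of_real R ^ 2 / \<zeta> t) = of_real R ^ 2 * (\<zeta> t - z) / \<zeta> t"
      using nz by (simp add: field_simps)
    then have "cnj (k (\<zeta> t)) = cnj (h (\<zeta> t)) *
        (of_real R ^ 2 * (of_real R ^ 2 / \<zeta> t) / (of_real R ^ 2 * (\<zeta> t - z) / \<zeta> t) ^ 2)"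
      by (simp add: k_def c)
    also have "of_real R ^ 2 * (of_real R ^ 2 / \<zeta> t) / (of_real R ^ 2 * (\<zeta> t - z) / \<zeta> t) ^ 2 = \<zeta> t / (\<zeta> t - z) ^ 2"
    proof -
      have *: "a * (a / s) / (a * b / s) ^ 2 = s / b ^ 2" if "a \<noteq> 0" "b \<noteq> 0" "s \<noteq> 0" for a b s :: complex
        using that by (simp add: field_simps power2_eq_square)
      show ?thesis by (rule *) (use nz R in auto)
    qed
    finally show ?thesis .
  qed
  ultimately have 2: "((\<lambda>t. cnj (h (\<zeta> t)) * (\<zeta> t / (\<zeta> t - z) ^ 2)) has_integral 0) {0..2*pi}"
    by simp
  have 3: "((\<lambda>t. of_real (2 * Re (h (\<zeta> t))) * (\<zeta> t / (\<zeta> t - z) ^ 2)) has_integral 2 * of_real pi * deriv h z) {0..2*pi}"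
  proof -
    have *: "of_real (2 * Re w) * q = w * q + cnj w * q" for w q
      by (simp add: ring_distribs(2)[symmetric] complex_add_cnj)
    show ?thesis unfolding * using has_integral_add[OF 1 2] by simp
  qed
  have "continuous_on (sphere 0 R) (\<lambda>w. \<bar>Re (h w)\<bar>)"
    using cont by (intro continuous_intros) (auto intro: continuous_on_subset)
  then have ci: "(\<lambda>t. \<bar>Re (h (\<zeta> t))\<bar>) integrable_on {0..2*pi}"
    unfolding \<zeta>_def using R by (intro integrable_continuous_real continuous_on_circle[where F = "\<lambda>w. \<bar>Re (h w)\<bar>"])
  \<comment> \<open>The constant 8 is 2 from \<open>2 * Re h\<close> times 4 from
    \<open>norm (\<zeta> t - z) \<ge> R / 2\<close>.\<close>
  have "norm (integral {0..2*pi} (\<lambda>t. of_real (2 * Re (h (\<zeta> t))) * (\<zeta> t / (\<zeta> t - z) ^ 2)))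
      \<le> integral {0..2*pi} (\<lambda>t. 8 / R * \<bar>Re (h (\<zeta> t))\<bar>)"
  proof (rule integral_norm_bound_integral)
    fix t
    have "R / 2 \<le> norm (\<zeta> t - z)"
      using norm_triangle_ineq2[of "\<zeta> t" z] z R by (simp add: \<zeta>_def norm_mult)
    then have "(R / 2) ^ 2 \<le> norm (\<zeta> t - z) ^ 2" using R by (intro power_mono) auto
    then have "R / norm (\<zeta> t - z) ^ 2 \<le> R / (R / 2) ^ 2"
      using R by (intro divide_left_mono mult_pos_pos) (auto intro: less_le_trans[of _ "(R/2)^2"])
    also have "\<dots> = 4 / R" using R by (simp add: power2_eq_square)
    finally have "2 * \<bar>Re (h (\<zeta> t))\<bar> * (R / norm (\<zeta> t - z) ^ 2) \<le> 2 * \<bar>Re (h (\<zeta> t))\<bar> * (4 / R)"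
      by (intro mult_left_mono) auto
    then show "norm (of_real (2 * Re (h (\<zeta> t))) * (\<zeta> t / (\<zeta> t - z) ^ 2)) \<le> 8 / R * \<bar>Re (h (\<zeta> t))\<bar>"
      using R by (simp add: norm_mult norm_divide norm_power \<zeta>_def field_simps)
  qed (use has_integral_integrable[OF 3] has_integral_integrable[OF has_integral_mult_right[OF integrable_integral[OF ci], of "8 / R"]]
       in simp_all)
  then have "2 * pi * norm (deriv h z) \<le> 8 / R * integral {0..2*pi} (\<lambda>t. \<bar>Re (h (\<zeta> t))\<bar>)"
    using integral_unique[OF 3] by (simp add: norm_mult)
  then show ?thesis using R by (simp add: \<zeta>_def field_simps)
qed

text \<open>The closed half disc is convex, so the uniform derivative bound on it yields a Lipschitz
  bound.\<close>

lemma diff_bound_circle_Re: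
  assumes h: "h holomorphic_on ball 0 R'" and R: "0 < R" "R < R'"
    and z: "norm z \<le> R / 2" "norm w \<le> R / 2"
  shows "norm (h w - h z) \<le> 4 / (pi * R) * integral {0..2*pi} (\<lambda>t. \<bar>Re (h (of_real R * cis t))\<bar>) * norm (w - z)"
proof (rule field_differentiable_bound[where S = "cball 0 (R / 2)"])
  fix x :: complex assume x: "x \<in> cball 0 (R / 2)"
  then have "x \<in> ball 0 R'" using R by auto
  then show "(h has_field_derivative deriv h x) (at x within cball 0 (R / 2))"
    using h by (meson holomorphic_derivI open_ball has_field_derivative_at_within)
  show "norm (deriv h x) \<le> 4 / (pi * R) * integral {0..2*pi} (\<lambda>t. \<bar>Re (h (of_real R * cis t))\<bar>)"
    using x by (intro deriv_bound_circle_Re[OF h R]) auto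
qed (use z in auto)

text \<open>On the circle the quotient \<open>norm (of_real R * cis t - p) / R\<close> equals
  \<open>norm (1 - cnj w * cis t)\<close> with \<open>w = p / R\<close>. Unlike the linear factor
  itself, \<open>1 - cnj w * u\<close> has no zero in the closed unit disc, and its logarithm
  vanishes at the centre.\<close>

lemma has_integral_ln_norm_circle:
  assumes R: "0 < R" and p: "norm p < R"
  shows "((\<lambda>t. ln (norm (of_real R * cis t - p) / R)) has_integral 0) {0..2*pi}"
proof -
  define w where "w = p / of_real R"
  have w: "norm w < 1" using R p by (simp add: w_def norm_divide)
  \<comment> \<open>For \<open>p \<noteq> 0\<close> this is \<open>1 / norm w\<close>, the modulus
    of the zero of \<open>1 - cnj w * u\<close>; for \<open>p = 0\<close> any radius above 1 would
    do.\<close>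
  define \<rho> where "\<rho> = (if p = 0 then 2 else R / norm p)"
  have rho: "1 < \<rho>" using R p by (simp add: \<rho>_def)
  have re: "0 < Re (1 - cnj w * u)" if "u \<in> ball 0 \<rho>" for u
  proof -
    have "norm (cnj w * u) < 1"
      using that R by (cases "p = 0") (auto simp: w_def \<rho>_def norm_mult norm_divide field_simps)
    moreover have "Re (cnj w * u) \<le> norm (cnj w * u)" by (rule complex_Re_le_cmod)
    ultimately show ?thesis by simp
  qed
  have ne: "1 - cnj w * u \<noteq> 0" if "u \<in> ball 0 \<rho>" for u
    using re[OF that] by (metis zero_complex.sel(1) less_irrefl)
  have "(\<lambda>u. Ln (1 - cnj w * u)) holomorphic_on ball 0 \<rho>"
    using re by (intro holomorphic_intros) (fastforce simp: complex_nonpos_Reals_iff)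
  then have "((\<lambda>t. Ln (1 - cnj w * (of_real 1 * cis t))) has_integral 0) {0..2*pi}"
    using holomorphic_circle_mean[of "\<lambda>u. Ln (1 - cnj w * u)" \<rho> 1] rho by simp
  then have "((\<lambda>t. Re (Ln (1 - cnj w * (of_real 1 * cis t)))) has_integral Re 0) {0..2*pi}"
    by (rule has_integral_Re)
  moreover have "Re (Ln (1 - cnj w * (of_real 1 * cis t))) = ln (norm (of_real R * cis t - p) / R)" for t
  proof -
    have "norm (1 - cnj w * cis t) = norm (cnj (1 - cnj w * cis t))" by (rule complex_mod_cnj[symmetric])
    also have "cnj (1 - cnj w * cis t) = (of_real R * cis t - p) * (cis (- t) / of_real R)"
      using R by (simp add: w_def field_simps cis_cnj cis_mult)
    also have "norm \<dots> = norm (of_real R * cis t - p) / R"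
      using R by (simp add: norm_mult norm_divide)
    finally show ?thesis using ne[of "cis t"] rho by simp
  qed
  ultimately show ?thesis by simp
qed

lemma continuous_on_ln_norm_circle:
  assumes R: "0 < R" and p: "norm p < R"
  shows "continuous_on A (\<lambda>t. ln (norm (of_real R * cis t - p) / R))"
proof -
  have "of_real R * cis t \<noteq> p" for t using R p by (auto simp: norm_mult)
  then show ?thesis using R by (intro continuous_intros) auto
qed

text \<open>The logarithm \<open>u\<close> has mean zero and is at most \<open>ln 2\<close>, whence
  \<open>\<bar>u\<bar> \<le> 2 * ln 2 - u\<close>. Integrating gives a bound independent of
  \<open>p\<close> and \<open>R\<close>.\<close>

lemma integral_abs_ln_norm_circle:
  assumes R: "0 < R" and p: "norm p < R"
  shows "integral {0..2*pi} (\<lambda>t. \<bar>ln (norm (of_real R * cis t - p) / R)\<bar>) \<le> 4 * pi * ln 2"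
proof -
  have "((\<lambda>t. 2 * ln 2 - ln (norm (of_real R * cis t - p) / R)) has_integral (2 * ln 2) * (2 * pi) - 0) {0..2*pi}"
    using has_integral_const_real[of "2 * ln 2 :: real" 0 "2 * pi"]
    by (intro has_integral_diff has_integral_ln_norm_circle[OF R p]) (auto simp: mult_ac)
  moreover have "\<bar>ln (norm (of_real R * cis t - p) / R)\<bar> \<le> 2 * ln 2 - ln (norm (of_real R * cis t - p) / R)" for t
  proof -
    have "of_real R * cis t \<noteq> p" using R p by (auto simp: norm_mult)
    moreover have "norm (of_real R * cis t - p) \<le> 2 * R"
      using norm_triangle_ineq4[of "of_real R * cis t" p] R p by simp
    ultimately have "ln (norm (of_real R * cis t - p) / R) \<le> ln 2"
      using R by (subst ln_le_cancel_iff) (auto simp: field_simps)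
    moreover have "0 \<le> ln (2::real)" by simp
    ultimately show ?thesis by linarith
  qed
  ultimately have "integral {0..2*pi} (\<lambda>t. \<bar>ln (norm (of_real R * cis t - p) / R)\<bar>) \<le> (2 * ln 2) * (2 * pi) - 0"
    by (intro has_integral_le[OF integrable_integral])
      (auto intro!: integrable_continuous_real continuous_on_rabs continuous_on_ln_norm_circle[OF R p])
  then show ?thesis by (simp add: mult_ac)
qed

text \<open>The two distances differ by at most \<open>norm \<eta>\<close>, so each one-sided
  difference of logarithms is bounded by \<open>ln (1 + norm \<eta> / b)\<close>, with
  \<open>b\<close> the subtracted distance. Writing \<open>z + \<eta> - p\<close> as
  \<open>z - (p - \<eta>)\<close> makes both terms kernels in \<open>z\<close>.\<close>

lemma abs_ln_shift_le:
  fixes z p \<eta> :: complex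
  assumes "z \<noteq> p" "z + \<eta> \<noteq> p" "0 < \<delta>" "\<delta> \<le> 1"
  shows "\<bar>ln (norm (z + \<eta> - p)) - ln (norm (z - p))\<bar>
     \<le> 2 / \<delta> * norm \<eta> powr \<delta> * (norm (z - p) powr - \<delta> + norm (z - (p - \<eta>)) powr - \<delta>)"
proof -
  have *: "ln a - ln b \<le> 2 / \<delta> * norm \<eta> powr \<delta> * b powr - \<delta>"
    if "0 < a" "0 < b" "a \<le> b + norm \<eta>" for a b
  proof -
    have "a \<le> b * (1 + norm \<eta> / b)" using that by (simp add: ring_distribs)
    then have "ln a \<le> ln (b * (1 + norm \<eta> / b))"
      using that by (subst ln_le_cancel_iff) (auto intro!: mult_pos_pos add_pos_nonneg)
    also have "\<dots> = ln b + ln (1 + norm \<eta> / b)"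
      using that add_pos_nonneg[of 1 "norm \<eta> / b"] by (intro ln_mult_pos) auto
    also have "ln (1 + norm \<eta> / b) \<le> 2 / \<delta> * (norm \<eta> / b) powr \<delta>"
      using assms that by (intro ln_one_plus_le_powr) auto
    also have "(norm \<eta> / b) powr \<delta> = norm \<eta> powr \<delta> * b powr - \<delta>"
      using that by (simp add: powr_divide powr_minus field_simps)
    finally show ?thesis by simp
  qed
  have a: "norm (z + \<eta> - p) \<le> norm (z - p) + norm \<eta>"
    using norm_triangle_ineq[of "z - p" \<eta>] by (simp add: algebra_simps)
  have b: "norm (z - p) \<le> norm (z + \<eta> - p) + norm \<eta>"
    using norm_triangle_ineq4[of "z + \<eta> - p" \<eta>] by (simp add: algebra_simps)
  have eq: "z - (p - \<eta>) = z + \<eta> - p" by simp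
  have nn: "0 \<le> 2 / \<delta> * norm \<eta> powr \<delta> * x powr - \<delta>" for x using assms by simp
  have "ln (norm (z + \<eta> - p)) - ln (norm (z - p)) \<le> 2 / \<delta> * norm \<eta> powr \<delta> * norm (z - p) powr - \<delta>"
    using a assms by (intro *) auto
  moreover have "ln (norm (z - p)) - ln (norm (z + \<eta> - p)) \<le> 2 / \<delta> * norm \<eta> powr \<delta> * norm (z + \<eta> - p) powr - \<delta>"
    using b assms by (intro *) auto
  ultimately show ?thesis
    using nn[of "norm (z + \<eta> - p)"] nn[of "norm (z - p)"]
    unfolding eq ring_distribs abs_le_iff by linarith
qed

subsection \<open>Factorisation and Jensen's formula\<close>

lemma log_plus_nonneg [simp]: "0 \<le> log_plus x"
  by (simp add: log_plus_def)

lemma log_plus_eq: "0 < x \<Longrightarrow> log_plus x = (\<bar>ln x\<bar> + ln x) / 2"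
  by (auto simp: log_plus_def max_def abs_if)

lemma ln_power_int: "0 < x \<Longrightarrow> ln (x powi n) = of_int n * ln x" for x :: real
  using powr_real_of_int'[of x n] by (metis less_eq_real_def ln_powr less_irrefl)

text \<open>Non-vanishing is stated up to sparse sets because the values of \<open>f\<close> on a
  sparse set are arbitrary.\<close>

locale nonzero_meromorphic =
  fixes f :: "complex \<Rightarrow> complex"
  assumes mero: "f meromorphic_on UNIV" and nonzero: "\<not> (\<forall>\<^sub>\<approx>z\<in>UNIV. f z = 0)"
begin

text \<open>
  The origin is included so that the term \<open>n(0) ln r\<close> of the counting function is an ordinary
  summand over \<open>divisor r\<close>. Points with \<open>zorder f p = 0\<close> are harmless in such sums.
\<close>

definition bad :: "complex set" where
  "bad = {z. z = 0 \<or> \<not> f analytic_on {z} \<or> f z = 0}"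

definition divisor :: "real \<Rightarrow> complex set" where
  "divisor R = bad \<inter> cball 0 R"

definition divisor_count :: "real \<Rightarrow> real" where
  "divisor_count R = (\<Sum>p\<in>divisor R. \<bar>real_of_int (zorder f p)\<bar>)"

text \<open>The first nonzero Laurent coefficient at the origin, which stands in for
  \<open>f 0\<close> in Jensen's formula.\<close>

definition leading_coeff :: complex where
  "leading_coeff = zor_poly f 0 0"

lemma sparse_bad: "bad sparse_in UNIV"
proof -
  have "\<forall>\<^sub>\<approx>z\<in>UNIV. f z \<noteq> 0"
    using meromorphic_imp_constant_or_avoid[OF mero, of 0] nonzero by auto
  then have "{z. \<not> f z \<noteq> 0} sparse_in UNIV" by (simp only: eventually_cosparse)
  moreover have "{z. \<not> f analytic_on {z}} sparse_in UNIV"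
    using meromorphic_on_imp_analytic_cosparse[OF mero] by (simp only: eventually_cosparse)
  ultimately have "({z. \<not> f z \<noteq> 0} \<union> {z. \<not> f analytic_on {z}}) \<union> {0} sparse_in UNIV"
    by (intro sparse_in_union') auto
  also have "({z. \<not> f z \<noteq> 0} \<union> {z. \<not> f analytic_on {z}}) \<union> {0} = bad"
    by (auto simp: bad_def)
  finally show ?thesis .
qed

lemma eventually_not_bad: "eventually (\<lambda>w. w \<notin> bad) (at p)"
  using sparse_bad by (simp add: sparse_in_eventually_iff)

lemma eventually_nonzero: "eventually (\<lambda>w. f w \<noteq> 0) (at p)"
  using eventually_not_bad by (rule eventually_mono) (auto simp: bad_def)

lemma finite_divisor [simp]: "finite (divisor R)"
  using sparse_in_compact_finite[of bad "cball 0 R"] sparse_bad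
  by (simp add: divisor_def Int_commute sparse_in_subset)

lemma zero_in_divisor [simp]: "0 \<le> R \<Longrightarrow> 0 \<in> divisor R"
  by (simp add: divisor_def bad_def)

lemma isolated: "isolated_singularity_at f p" and not_ess: "not_essential f p"
  using mero meromorphic_at_iff by (auto intro: meromorphic_on_subset)

lemma zorder_factor: "zor_poly f p p \<noteq> 0"
  "\<exists>r>0. zor_poly f p holomorphic_on cball p r \<and>
     (\<forall>w\<in>cball p r - {p}. f w = zor_poly f p w * (w - p) powi zorder f p)"
  using zorder_exist[OF isolated not_ess, of p] eventually_frequently[OF _ eventually_nonzero[of p]] by auto

text \<open>The factor of \<open>P\<close> at \<open>p\<close> cancels the power of
  \<open>w - p\<close> in the local factorisation of \<open>f\<close>, and the remaining factors are
  continuous and nonzero at \<open>p\<close>. Hence \<open>f / P\<close> extends across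
  \<open>p\<close> without a zero.\<close>

lemma divisor_quotient_limit:
  assumes "0 < R" "p \<in> divisor R"
  defines "P \<equiv> \<lambda>z. \<Prod>p\<in>divisor R. ((z - p) / of_real R) powi zorder f p"
  shows "\<exists>c. c \<noteq> 0 \<and> (\<lambda>z. f z / P z) \<midarrow>p\<rightarrow> c"
proof -
  define Q where "Q = (\<lambda>z. \<Prod>q\<in>divisor R - {p}. ((z - q) / of_real R) powi zorder f q)"
  define k where "k = zorder f p"
  have Q: "Q p \<noteq> 0" using assms by (auto simp: Q_def)
  have contQ: "isCont Q p"
    unfolding Q_def using assms by (intro continuous_intros) auto
  obtain r where r: "r > 0" "zor_poly f p holomorphic_on cball p r"
      "\<And>w. w \<in> cball p r - {p} \<Longrightarrow> f w = zor_poly f p w * (w - p) powi k"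
    using zorder_factor(2)[of p] unfolding k_def by blast
  have contz: "isCont (zor_poly f p) p"
    using r(1,2) by (intro analytic_at_imp_isCont)
      (auto simp: analytic_at intro!: exI[of _ "ball p r"] intro: holomorphic_on_subset)
  have "eventually (\<lambda>w. w \<in> ball p r - {p}) (at p)" using r by (intro eventually_at_in_open) auto
  then have ev: "eventually (\<lambda>w. zor_poly f p w * of_real R powi k / Q w = f w / P w) (at p)"
  proof eventually_elim
    case (elim w)
    have "P w = ((w - p) / of_real R) powi k * Q w"
      unfolding P_def Q_def k_def using assms by (subst prod.remove[of _ p]) auto
    then show ?case using elim r(3)[of w] assms by (simp add: power_int_divide_distrib)
  qed
  have "(\<lambda>w. zor_poly f p w * of_real R powi k / Q w) \<midarrow>p\<rightarrow> zor_poly f p p * of_real R powi k / Q p"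
    using Q contQ contz by (intro tendsto_intros) (auto simp: isCont_def)
  then have "(\<lambda>w. f w / P w) \<midarrow>p\<rightarrow> zor_poly f p p * of_real R powi k / Q p"
    using tendsto_cong[OF ev] by blast
  moreover have "zor_poly f p p * of_real R powi k / Q p \<noteq> 0"
    using zorder_factor(1) Q assms by simp
  ultimately show ?thesis by blast
qed

text \<open>
  Restricting to radii whose circle avoids \<open>bad\<close> makes all logarithms on the circle continuous.
\<close>

definition good_radius :: "real \<Rightarrow> bool" where
  "good_radius R \<longleftrightarrow> (\<exists>R'>R. bad \<inter> cball 0 R' \<subseteq> ball 0 R)"

text \<open>
  Logarithmic form of \<open>f z = (\<Prod>p. ((z - p) / R) powi zorder f p) * exp (h z)\<close>. Dividing by \<open>R\<close> gives
  each factor logarithmic mean \<open>0\<close> over the circle of radius \<open>R\<close>.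
\<close>

definition log_factor :: "real \<Rightarrow> real \<Rightarrow> (complex \<Rightarrow> complex) \<Rightarrow> bool" where
  "log_factor R R' h \<longleftrightarrow> R < R' \<and> bad \<inter> cball 0 R' \<subseteq> ball 0 R \<and> h holomorphic_on ball 0 R' \<and>
     (\<forall>z\<in>ball 0 R' - bad.
        ln (norm (f z)) = Re (h z) + (\<Sum>p\<in>divisor R. of_int (zorder f p) * ln (norm (z - p) / R)))"

text \<open>Once its removable singularities are filled in, \<open>f / P\<close> is analytic and
  zero-free on a disc, so it has a holomorphic logarithm \<open>h\<close> there.\<close>

lemma log_factor_exists:
  assumes R: "0 < R" and "good_radius R"
  shows "\<exists>R' h. log_factor R R' h"
proof -
  obtain R' where R': "R < R'" and gap: "bad \<inter> cball 0 R' \<subseteq> ball 0 R"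
    using assms by (auto simp: good_radius_def)
  define P where "P = (\<lambda>z. \<Prod>p\<in>divisor R. ((z - p) / of_real R) powi zorder f p)"
  define g where "g = (\<lambda>z. f z / P z)"
  have Pnz: "P z \<noteq> 0" if "z \<notin> bad" for z
  proof -
    have "z \<notin> divisor R" using that by (simp add: divisor_def)
    then show ?thesis using R by (auto simp: P_def)
  qed
  have Pan: "P analytic_on {z}" if "z \<notin> bad" for z
    unfolding P_def using that R by (intro analytic_intros) (auto simp: divisor_def)
  have gan: "g analytic_on {z}" "g z \<noteq> 0" if "z \<notin> bad" for z
    using that Pnz Pan unfolding g_def by (auto intro!: analytic_intros simp: bad_def)
  have iso: "isolated_singularity_at g p" for p
  proof -
    obtain e where e: "e > 0" "\<forall>w. w \<noteq> p \<and> dist w p < e \<longrightarrow> w \<notin> bad"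
      using eventually_not_bad[of p] unfolding eventually_at by auto
    then have "g analytic_on ball p e - {p}"
      using gan(1) by (subst analytic_on_analytic_at) (auto simp: dist_commute)
    then show ?thesis unfolding isolated_singularity_at_def using e by auto
  qed
  define G where "G = remove_sings g"
  have G: "G analytic_on {z} \<and> G z \<noteq> 0" if z: "z \<in> ball 0 R'" for z
  proof (cases "z \<in> bad")
    case False
    then show ?thesis using gan[of z] by (simp add: G_def remove_sings_analytic_on)
  next
    case True
    \<comment> \<open>The annulus between the two radii contains no bad points, so \<open>P\<close>
      accounts for every bad point of the larger disc.\<close>
    then have "z \<in> divisor R" using z gap by (auto simp: divisor_def)
    then obtain c where "c \<noteq> 0" "g \<midarrow>z\<rightarrow> c"
      using divisor_quotient_limit[OF R] unfolding g_def P_def by blast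
    then show ?thesis
      using remove_sings_analytic_at[OF iso] remove_sings_eqI by (auto simp: G_def)
  qed
  have "G holomorphic_on ball 0 R'"
    using G by (intro analytic_imp_holomorphic) (metis analytic_on_analytic_at)
  then obtain h where h: "h holomorphic_on ball 0 R'" "\<And>z. z \<in> ball 0 R' \<Longrightarrow> exp (h z) = G z"
    using holomorphic_logarithm_exists[of "ball 0 R'" G 0] G R R' by auto
  have "ln (norm (f z)) = Re (h z) + (\<Sum>p\<in>divisor R. of_int (zorder f p) * ln (norm (z - p) / R))"
    if z: "z \<in> ball 0 R' - bad" for z
  proof -
    have "G z = g z" using gan z by (simp add: G_def)
    then have "f z = exp (h z) * P z" using h(2)[of z] Pnz[of z] z by (simp add: g_def)
    then have "norm (f z) = exp (Re (h z)) * norm (P z)" by (simp add: norm_mult)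
    then have "ln (norm (f z)) = Re (h z) + ln (norm (P z))"
      using Pnz[of z] z by (simp add: ln_mult)
    also have "norm (P z) = (\<Prod>p\<in>divisor R. (norm (z - p) / R) powi zorder f p)"
      using R by (simp add: P_def prod_norm[symmetric] norm_power_int norm_divide)
    also have "ln \<dots> = (\<Sum>p\<in>divisor R. ln ((norm (z - p) / R) powi zorder f p))"
      using z R by (intro ln_prod finite_divisor) (auto simp: divisor_def)
    also have "\<dots> = (\<Sum>p\<in>divisor R. of_int (zorder f p) * ln (norm (z - p) / R))"
    proof (intro sum.cong refl)
      fix p assume "p \<in> divisor R"
      then have "z \<noteq> p" using z by (auto simp: divisor_def)
      then have "0 < norm (z - p) / R" using R by simp
      then show "ln ((norm (z - p) / R) powi zorder f p) = of_int (zorder f p) * ln (norm (z - p) / R)"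
        by (rule ln_power_int)
    qed
    finally show ?thesis .
  qed
  then show ?thesis unfolding log_factor_def using R' gap h(1) by blast
qed

text \<open>The contribution of a point \<open>p\<close> to the integrated counting function at radius \<open>R\<close>.\<close>

definition height :: "real \<Rightarrow> complex \<Rightarrow> real" where
  "height R p = (if p = 0 then ln R else ln (R / norm p))"

lemma height_nonneg: "1 \<le> R \<Longrightarrow> p \<in> divisor R \<Longrightarrow> 0 \<le> height R p"
  by (auto simp: height_def divisor_def)

text \<open>Near the origin both sides of the factorisation contain
  \<open>zorder f 0 * ln (norm w)\<close>. Cancelling it and letting \<open>w\<close> tend to
  \<open>0\<close> identifies the constant term; the normalisation by \<open>R\<close> leaves the
  \<open>ln R\<close> in \<open>height R 0\<close>.\<close>

lemma log_factor_at_0: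
  assumes "0 < R" "log_factor R R' h"
  shows "Re (h 0) = ln (norm leading_coeff) + (\<Sum>p\<in>divisor R. of_int (zorder f p) * height R p)"
proof -
  have R: "0 < R" "R < R'" and h: "h holomorphic_on ball 0 R'"
    and rep: "\<And>z. z \<in> ball 0 R' - bad \<Longrightarrow>
       ln (norm (f z)) = Re (h z) + (\<Sum>p\<in>divisor R. of_int (zorder f p) * ln (norm (z - p) / R))"
    using assms unfolding log_factor_def by blast+
  define k where "k = zorder f 0"
  define S where "S = (\<lambda>z. \<Sum>p\<in>divisor R - {0}. of_int (zorder f p) * ln (norm (z - p) / R))"
  obtain r where r: "r > 0" "zor_poly f 0 holomorphic_on cball 0 r"
      "\<And>w. w \<in> cball 0 r - {0} \<Longrightarrow> f w = zor_poly f 0 w * (w - 0) powi k"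
    using zorder_factor(2)[of 0] unfolding k_def by blast
  have contz: "isCont (zor_poly f 0) 0"
    using r(1,2) by (intro analytic_at_imp_isCont)
      (auto simp: analytic_at intro!: exI[of _ "ball 0 r"] intro: holomorphic_on_subset)
  have conth: "isCont h 0"
    using h R by (intro analytic_at_imp_isCont) (auto simp: analytic_at intro!: exI[of _ "ball 0 R'"])
  have "eventually (\<lambda>w. w \<in> ball 0 r - {0}) (at 0)" using r by (intro eventually_at_in_open) auto
  moreover have "eventually (\<lambda>w::complex. w \<in> ball 0 R' - {0}) (at 0)" using R by (intro eventually_at_in_open) auto
  ultimately have ev: "eventually (\<lambda>w. Re (h w) - of_int k * ln R + S w = ln (norm (zor_poly f 0 w))) (at 0)"
    using eventually_not_bad[of 0] eventually_nonzero[of 0]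
  proof eventually_elim
    case (elim w)
    have nz: "zor_poly f 0 w \<noteq> 0" using elim r(3)[of w] by auto
    have pos: "0 < norm w" using elim by auto
    have "ln (norm (f w)) = ln (norm (zor_poly f 0 w)) + ln (norm w powi k)"
      using r(3)[of w] elim nz by (simp add: norm_mult norm_power_int ln_mult)
    also have "ln (norm w powi k) = of_int k * ln (norm w)"
      using pos by (rule ln_power_int)
    finally have 1: "ln (norm (f w)) = ln (norm (zor_poly f 0 w)) + of_int k * ln (norm w)" .
    have "ln (norm (f w)) = Re (h w) + (of_int k * ln (norm w / R) + S w)"
      using rep[of w] elim R sum.remove[of "divisor R" 0 "\<lambda>p. of_int (zorder f p) * ln (norm (w - p) / R)"]
      unfolding S_def k_def by simp
    also have "ln (norm w / R) = ln (norm w) - ln R" using pos R by (intro ln_divide_pos) auto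
    finally show ?case using 1 by (simp add: algebra_simps)
  qed
  have "(\<lambda>w. Re (h w) - of_int k * ln R + S w) \<midarrow>0\<rightarrow> Re (h 0) - of_int k * ln R + S 0"
    unfolding S_def using R conth by (intro tendsto_intros) (auto simp: isCont_def)
  moreover have "(\<lambda>w. ln (norm (zor_poly f 0 w))) \<midarrow>0\<rightarrow> ln (norm (zor_poly f 0 0))"
    using contz zorder_factor(1)[of 0] by (intro tendsto_intros) (auto simp: isCont_def)
  ultimately have "Re (h 0) - of_int k * ln R + S 0 = ln (norm leading_coeff)"
    unfolding leading_coeff_def using tendsto_cong[OF ev] LIM_unique by blast
  moreover have "(\<Sum>p\<in>divisor R. of_int (zorder f p) * height R p) = of_int k * ln R - S 0"
  proof -
    have "(\<Sum>p\<in>divisor R. of_int (zorder f p) * height R p)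
        = of_int k * ln R + (\<Sum>p\<in>divisor R - {0}. of_int (zorder f p) * height R p)"
      using R by (subst sum.remove[of _ 0]) (auto simp: height_def k_def)
    also have "(\<Sum>p\<in>divisor R - {0}. of_int (zorder f p) * height R p) = - S 0"
      unfolding S_def sum_negf[symmetric] using R
      by (intro sum.cong) (auto simp: height_def ln_div algebra_simps)
    finally show ?thesis by simp
  qed
  ultimately show ?thesis by simp
qed

section \<open>The integrated counting function as a sum over the divisor\<close>

lemma pole_count_eq:
  assumes "0 \<le> t" "t \<le> R"
  shows "real (pole_count t f) = (\<Sum>p\<in>divisor R. if norm p \<le> t then of_nat (nat (- zorder f p)) else 0)"
proof -
  have "{z. is_pole f z \<and> norm z \<le> t} \<subseteq> divisor R"
    using assms analytic_at_imp_no_pole by (auto simp: divisor_def bad_def)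
  moreover have "nat (- zorder f z) = 0" if "\<not> is_pole f z" for z
    using that zorder_neg_imp_is_pole[of f z] eventually_nonzero[of z] mero
    by (meson meromorphic_on_subset not_less subset_UNIV nat_0_iff neg_le_0_iff_le)
  ultimately have "pole_count t f = (\<Sum>z\<in>divisor R. if norm z \<le> t then nat (- zorder f z) else 0)"
    unfolding pole_count_def by (intro sum.mono_neutral_cong_left) auto
  then show ?thesis by (simp add: of_nat_sum if_distrib cong: if_cong)
qed

text \<open>With a finite index set independent of \<open>t\<close>, the sum can be integrated term
  by term: a pole \<open>p \<noteq> 0\<close> enters at \<open>t = norm p\<close> and contributes
  the integral of \<open>1 / t\<close> from there to \<open>R\<close>.\<close>

lemma pole_counting_eq:
  assumes R: "1 \<le> R"
  shows "pole_counting R f = (\<Sum>p\<in>divisor R. of_nat (nat (- zorder f p)) * height R p)"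
proof -
  define m where "m = (\<lambda>p. real (nat (- zorder f p)))"
  have 0: "real (pole_count 0 f) = m 0"
    using R pole_count_eq[of 0 R] sum.remove[of "divisor R" 0 "\<lambda>p. if norm p \<le> 0 then m p else 0"]
    by (simp add: m_def)
  have int: "((\<lambda>t. if norm p \<le> t then 1 / t else 0) has_integral ln (R / norm p)) {0..R}"
    if "p \<in> divisor R - {0}" for p
  proof -
    have p: "0 < norm p" "norm p \<le> R" using that by (auto simp: divisor_def)
    have "((\<lambda>t. 1 / t) has_integral ln R - ln (norm p)) {norm p..R}"
      using p by (intro fundamental_theorem_of_calculus)
        (auto intro!: derivative_eq_intros less_le_trans[OF p(1)]
          simp: has_real_derivative_iff_has_vector_derivative[symmetric])
    then have "((\<lambda>t. if t \<in> {norm p..R} then 1 / t else 0) has_integral ln R - ln (norm p)) {0..R}"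
      using p by (subst has_integral_restrict) auto
    then have "((\<lambda>t. if norm p \<le> t then 1 / t else 0) has_integral ln R - ln (norm p)) {0..R}"
      by (rule has_integral_eq[rotated]) auto
    then show ?thesis using p R by (simp add: ln_div)
  qed
  have "((\<lambda>t. \<Sum>p\<in>divisor R - {0}. m p * (if norm p \<le> t then 1 / t else 0)) has_integral
      (\<Sum>p\<in>divisor R - {0}. m p * ln (R / norm p))) {0..R}"
    using int by (intro has_integral_sum has_integral_mult_right) auto
  then have "((\<lambda>t. (real (pole_count t f) - real (pole_count 0 f)) / t) has_integral
      (\<Sum>p\<in>divisor R - {0}. m p * ln (R / norm p))) {0..R}"
  proof (rule has_integral_eq[rotated])
    fix t assume t: "t \<in> {0..R}"
    have "real (pole_count t f) = m 0 + (\<Sum>p\<in>divisor R - {0}. if norm p \<le> t then m p else 0)"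
      using t R pole_count_eq[of t R] sum.remove[of "divisor R" 0 "\<lambda>p. if norm p \<le> t then m p else 0"]
      by (simp add: m_def cong: if_cong)
    then show "(\<Sum>p\<in>divisor R - {0}. m p * (if norm p \<le> t then 1 / t else 0))
        = (real (pole_count t f) - real (pole_count 0 f)) / t"
      unfolding 0 by (simp add: sum_divide_distrib) (intro sum.cong, auto)
  qed
  then have "pole_counting R f = (\<Sum>p\<in>divisor R - {0}. m p * ln (R / norm p)) + m 0 * ln R"
    unfolding pole_counting_def 0 by (simp add: integral_unique)
  also have "\<dots> = (\<Sum>p\<in>divisor R. m p * height R p)"
    using R by (subst (2) sum.remove[of _ 0]) (auto simp: height_def)
  finally show ?thesis by (simp add: m_def)
qed

end

section \<open>Finite exceptional sets on circles\<close>

lemma finite_circle_preimage: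
  assumes "finite T" "0 < r"
  shows "finite {t \<in> {0..2*pi}. of_real r * cis t \<in> T}"
proof (rule finite_subset)
  \<comment> \<open>\<open>Arg2pi\<close> recovers the parameter except at \<open>2 * pi\<close>,
    which gives the same point as \<open>0\<close>.\<close>
  show "{t \<in> {0..2*pi}. of_real r * cis t \<in> T} \<subseteq> insert (2 * pi) (Arg2pi ` T)"
  proof
    fix t assume t: "t \<in> {t \<in> {0..2*pi}. of_real r * cis t \<in> T}"
    have "Arg2pi (of_real r * cis t) = t" if "t \<noteq> 2 * pi"
      using t that assms by (intro Arg2pi_unique[of r]) (auto simp: cis_conv_exp)
    then show "t \<in> insert (2 * pi) (Arg2pi ` T)" using t by force
  qed
qed (use assms in auto)

text \<open>Changing the majorant on the finite set \<open>E\<close> keeps its integral. If the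
  integrand is not integrable, its integral is \<open>0\<close> by convention and
  \<open>0 \<le> I\<close> settles the claim.\<close>

lemma proximity_le:
  assumes E: "finite E" and H: "(H has_integral I) {0..2*pi}" "0 \<le> I"
    and le: "\<And>t. t \<in> {0..2*pi} - E \<Longrightarrow> log_plus (norm (g (of_real r * cis t))) \<le> H t"
  shows "proximity r g \<le> I / (2 * pi)"
proof -
  let ?L = "\<lambda>t. log_plus (norm (g (of_real r * cis t)))"
  have "integral {0..2*pi} ?L \<le> I"
  proof (cases "?L integrable_on {0..2*pi}")
    case True
    have "((\<lambda>t. if t \<in> E then ?L t else H t) has_integral I) {0..2*pi}"
      by (rule has_integral_spike_finite[OF E _ H(1)]) auto
    with integrable_integral[OF True] show ?thesis
      by (rule has_integral_le) (use le in auto)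
  qed (use H in \<open>simp add: not_integrable_integral\<close>)
  then show ?thesis by (simp add: proximity_def divide_right_mono)
qed

section \<open>Jensen's formula and bounds by the characteristic\<close>

context nonzero_meromorphic
begin

definition circle_log :: "real \<Rightarrow> real" where
  "circle_log R = integral {0..2*pi} (\<lambda>t. \<bar>ln (norm (f (of_real R * cis t)))\<bar>)"

text \<open>Only finitely many moduli of bad points lie below \<open>b\<close>. A radius avoiding
  them has a gap up to the next one.\<close>

lemma good_radius_exists:
  assumes "a < b"
  shows "\<exists>R. a < R \<and> R < b \<and> good_radius R"
proof -
  have "infinite ({a<..<b} - norm ` divisor b)"
    using assms by (intro Diff_infinite_finite) auto
  then have "{a<..<b} - norm ` divisor b \<noteq> {}" by (metis finite.emptyI)
  then obtain R where "R \<in> {a<..<b} - norm ` divisor b" by blast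
  then have R: "a < R" "R < b" "R \<notin> norm ` divisor b" unfolding Diff_iff greaterThanLessThan_iff by blast+
  \<comment> \<open>Inserting \<open>b\<close> keeps \<open>X\<close> nonempty and keeps
    \<open>R'\<close> below \<open>b\<close>, where \<open>divisor b\<close> contains all bad
    points.\<close>
  define X where "X = insert b {x \<in> norm ` divisor b. R < x}"
  have X: "finite X" "X \<noteq> {}" "\<And>x. x \<in> X \<Longrightarrow> R < x" using R by (auto simp: X_def)
  have MX: "R < Min X" using X by (subst Min_gr_iff) auto
  have MX': "Min X \<le> b" using X(1) by (rule Min_le) (simp add: X_def)
  define R' where "R' = (R + Min X) / 2"
  have R': "R < R'" "R' < Min X" using MX by (auto simp: R'_def)
  have "bad \<inter> cball 0 R' \<subseteq> ball 0 R"
  proof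
    fix p assume p: "p \<in> bad \<inter> cball 0 R'"
    then have pd: "p \<in> divisor b" using R' MX' by (auto simp: divisor_def)
    then have "norm p \<noteq> R" using R by auto
    moreover have "\<not> R < norm p"
    proof
      assume "R < norm p"
      then have "norm p \<in> X" using pd by (auto simp: X_def)
      then have "Min X \<le> norm p" using X by simp
      then show False using p R' by simp
    qed
    ultimately show "p \<in> ball 0 R" by simp
  qed
  then show ?thesis using R R' unfolding good_radius_def by blast
qed

lemma log_factor_on_circle:
  assumes "log_factor R R' h" and R: "0 < R"
  shows "f (of_real R * cis t) \<noteq> 0"
    and "ln (norm (f (of_real R * cis t))) = Re (h (of_real R * cis t))
       + (\<Sum>p\<in>divisor R. of_int (zorder f p) * ln (norm (of_real R * cis t - p) / R))"
    and "p \<in> divisor R \<Longrightarrow> norm p < R"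
    and "continuous_on {0..2*pi} (\<lambda>t. Re (h (of_real R * cis t)))"
proof -
  have R': "R < R'" and gap: "bad \<inter> cball 0 R' \<subseteq> ball 0 R" and h: "h holomorphic_on ball 0 R'"
    using assms by (auto simp: log_factor_def)
  have nb: "of_real R * cis t \<in> ball 0 R' - bad"
    using gap R R' by (auto simp: norm_mult)
  then show "f (of_real R * cis t) \<noteq> 0" by (auto simp: bad_def)
  show "ln (norm (f (of_real R * cis t))) = Re (h (of_real R * cis t))
       + (\<Sum>p\<in>divisor R. of_int (zorder f p) * ln (norm (of_real R * cis t - p) / R))"
    using assms(1) nb unfolding log_factor_def by blast
  show "norm p < R" if "p \<in> divisor R"
    using that gap R' by (auto simp: divisor_def)
  have "continuous_on (sphere 0 R) (\<lambda>z. Re (h z))"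
    using R' by (intro continuous_intros holomorphic_on_imp_continuous_on holomorphic_on_subset[OF h]) auto
  then show "continuous_on {0..2*pi} (\<lambda>t. Re (h (of_real R * cis t)))"
    using R by (intro continuous_on_circle[where F = "\<lambda>z. Re (h z)"]) auto
qed

text \<open>
  Jensen's formula, with \<open>circle_log\<close> playing the role of \<open>2 * pi * (m(R, f) + m(R, 1/f))\<close>.
\<close>

lemma jensen:
  assumes R: "1 \<le> R" "good_radius R"
  shows "circle_log R + 2 * pi * (ln (norm leading_coeff) + (\<Sum>p\<in>divisor R. of_int (zorder f p) * height R p))
     = 4 * pi * proximity R f"
proof -
  have R0: "0 < R" using R by simp
  obtain R' h where rep: "log_factor R R' h" using log_factor_exists[OF R0 R(2)] by blast
  then have *: "R < R'" "h holomorphic_on ball 0 R'" unfolding log_factor_def by blast+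
  note nz = log_factor_on_circle(1)[OF rep R0] and L = log_factor_on_circle(2)[OF rep R0]
    and pR = log_factor_on_circle(3)[OF rep R0] and cont = log_factor_on_circle(4)[OF rep R0]
  let ?L = "\<lambda>t. ln (norm (f (of_real R * cis t)))"
  have "((\<lambda>t. Re (h (of_real R * cis t))) has_integral Re (2 * of_real pi * h 0)) {0..2*pi}"
    using holomorphic_circle_mean[OF *(2) R0 *(1)] by (rule has_integral_Re)
  \<comment> \<open>Each normalised linear factor has logarithmic mean zero, so only
    \<open>h\<close> contributes.\<close>
  then have "(?L has_integral Re (2 * of_real pi * h 0) + (\<Sum>p\<in>divisor R. of_int (zorder f p) * 0)) {0..2*pi}"
    unfolding L using pR R0
    by (intro has_integral_add has_integral_sum has_integral_mult_right has_integral_ln_norm_circle) auto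
  then have I: "(?L has_integral 2 * pi * Re (h 0)) {0..2*pi}" by simp
  have "continuous_on {0..2*pi} ?L"
    unfolding L using pR R0
    by (intro continuous_on_add cont continuous_on_sum continuous_on_mult continuous_on_const
        continuous_on_ln_norm_circle) auto
  then have "((\<lambda>t. \<bar>?L t\<bar>) has_integral circle_log R) {0..2*pi}"
    unfolding circle_log_def
    by (intro integrable_integral integrable_continuous_real continuous_on_rabs)
  \<comment> \<open>The halving reflects
    \<open>log_plus x = (\<bar>ln x\<bar> + ln x) / 2\<close>.\<close>
  from has_integral_divide[OF has_integral_add[OF this I], of 2]
  have "((\<lambda>t. log_plus (norm (f (of_real R * cis t)))) has_integral (circle_log R + 2 * pi * Re (h 0)) / 2) {0..2*pi}"
    using nz by (simp add: log_plus_eq)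
  then have "4 * pi * proximity R f = circle_log R + 2 * pi * Re (h 0)"
    unfolding proximity_def by (simp add: integral_unique)
  also have "Re (h 0) = ln (norm leading_coeff) + (\<Sum>p\<in>divisor R. of_int (zorder f p) * height R p)"
    by (rule log_factor_at_0[OF R0 rep])
  finally show ?thesis by simp
qed

lemma circle_log_nonneg: "0 \<le> circle_log R"
  unfolding circle_log_def by (cases "(\<lambda>t. \<bar>ln (norm (f (of_real R * cis t)))\<bar>) integrable_on {0..2*pi}")
    (auto intro: integral_nonneg simp: not_integrable_integral)

lemma proximity_nonneg: "0 \<le> proximity R g"
proof -
  have "0 \<le> integral {0..2*pi} (\<lambda>t. log_plus (norm (g (of_real R * cis t))))"
    by (cases "(\<lambda>t. log_plus (norm (g (of_real R * cis t)))) integrable_on {0..2*pi}")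
      (auto intro: integral_nonneg simp: not_integrable_integral)
  then show ?thesis by (simp add: proximity_def)
qed

text \<open>Jensen's formula balances \<open>circle_log R\<close>, the zero part \<open>Z\<close>
  and the pole part \<open>N\<close> against the proximity term. Discarding the nonnegative
  \<open>Z\<close> gives the first bound, discarding the nonnegative \<open>circle_log R\<close> the
  second.\<close>

lemma characteristic_bounds:
  assumes R: "1 \<le> R" "good_radius R"
  shows "circle_log R \<le> 4 * pi * (nevanlinna_char R f + \<bar>ln (norm leading_coeff)\<bar>)"
    and "(\<Sum>p\<in>divisor R. \<bar>of_int (zorder f p)\<bar> * height R p)
           \<le> 2 * (nevanlinna_char R f + \<bar>ln (norm leading_coeff)\<bar>)"
proof -
  define N where "N = (\<Sum>p\<in>divisor R. of_nat (nat (- zorder f p)) * height R p)"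
  define Z where "Z = (\<Sum>p\<in>divisor R. of_nat (nat (zorder f p)) * height R p)"
  define l where "l = ln (norm leading_coeff)"
  define m where "m = proximity R f"
  have T: "nevanlinna_char R f = m + N"
    using pole_counting_eq[OF R(1)] by (simp add: nevanlinna_char_def N_def m_def)
  have pos: "0 \<le> N" "0 \<le> Z" "0 \<le> m"
    unfolding N_def Z_def m_def using height_nonneg[OF R(1)]
    by (auto intro!: sum_nonneg mult_nonneg_nonneg proximity_nonneg)
  have "(\<Sum>p\<in>divisor R. of_int (zorder f p) * height R p) = Z - N"
    unfolding Z_def N_def sum_subtractf[symmetric] left_diff_distrib[symmetric]
    by (intro sum.cong refl arg_cong2[of _ _ _ _ "(*)"]) auto
  then have J: "circle_log R + 2 * pi * (l + Z - N) = 4 * pi * m"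
    using jensen[OF R] by (simp add: l_def m_def add_diff_eq)
  have sum: "(\<Sum>p\<in>divisor R. \<bar>of_int (zorder f p)\<bar> * height R p) = Z + N"
    unfolding Z_def N_def sum.distrib[symmetric] ring_distribs(2)[symmetric]
    by (intro sum.cong refl arg_cong2[of _ _ _ _ "(*)"]) auto
  have "circle_log R = 2 * pi * (2 * m - l - Z + N)" using J by (simp add: algebra_simps)
  also have "\<dots> \<le> 2 * pi * (2 * (m + N + \<bar>l\<bar>))"
    using pos by (intro mult_left_mono) auto
  also have "\<dots> = 4 * pi * (m + N + \<bar>l\<bar>)" by simp
  finally show "circle_log R \<le> 4 * pi * (nevanlinna_char R f + \<bar>ln (norm leading_coeff)\<bar>)"
    by (simp add: T l_def)
  have "2 * pi * (l + Z - N) \<le> 2 * pi * (2 * m)" using J circle_log_nonneg[of R] by linarith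
  then have "l + Z - N \<le> 2 * m" by (rule mult_left_le_imp_le) simp
  then show "(\<Sum>p\<in>divisor R. \<bar>of_int (zorder f p)\<bar> * height R p)
           \<le> 2 * (nevanlinna_char R f + \<bar>ln (norm leading_coeff)\<bar>)"
    unfolding sum T using pos by (simp add: l_def[symmetric])
qed

text \<open>Every point of \<open>divisor r\<close> has height at least \<open>ln 2\<close> at a
  radius \<open>R \<ge> 2 * r\<close>; the origin is covered by \<open>R \<ge> 2\<close>.\<close>

lemma divisor_count_le:
  assumes "1 \<le> r" "2 * r \<le> R"
  shows "ln 2 * divisor_count r \<le> (\<Sum>p\<in>divisor R. \<bar>of_int (zorder f p)\<bar> * height R p)"
proof -
  have "ln 2 * divisor_count r = (\<Sum>p\<in>divisor r. \<bar>of_int (zorder f p)\<bar> * ln 2)"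
    by (simp add: divisor_count_def sum_distrib_left mult_ac)
  also have "\<dots> \<le> (\<Sum>p\<in>divisor r. \<bar>of_int (zorder f p)\<bar> * height R p)"
  proof (intro sum_mono mult_left_mono)
    fix p assume p: "p \<in> divisor r"
    then have "2 * norm p \<le> R" "2 \<le> R" using assms by (auto simp: divisor_def)
    then show "ln 2 \<le> height R p" by (auto simp: height_def field_simps)
  qed auto
  also have "\<dots> \<le> (\<Sum>p\<in>divisor R. \<bar>of_int (zorder f p)\<bar> * height R p)"
    using assms height_nonneg[of R] by (intro sum_mono2 finite_divisor) (auto simp: divisor_def)
  finally show ?thesis .
qed

section \<open>The logarithm of the shifted quotient, pointwise and in mean\<close>

lemma divisor_count_nonneg: "0 \<le> divisor_count R"
  by (simp add: divisor_count_def sum_nonneg)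

text \<open>Subtracting the factorisations at \<open>z + \<eta>\<close> and \<open>z\<close> cancels
  the normalisation by \<open>R\<close>. The linear factors give the power sum; the change of
  \<open>h\<close> gives the last term, since the factorisation on the circle bounds
  \<open>\<bar>Re h\<bar>\<close> by \<open>\<bar>ln \<bar>f\<bar>\<bar>\<close> plus the logarithms
  of the linear factors.\<close>

lemma log_shift_bound:
  assumes R: "1 \<le> R" "good_radius R" and \<delta>: "0 < \<delta>" "\<delta> \<le> 1"
    and z: "norm z \<le> R / 2" "norm (z + \<eta>) \<le> R / 2" "z \<notin> bad" "z + \<eta> \<notin> bad"
  shows "\<bar>ln (norm (f (z + \<eta>))) - ln (norm (f z))\<bar> \<le>
     (\<Sum>p\<in>divisor R. \<bar>of_int (zorder f p)\<bar> *
       (2 / \<delta> * norm \<eta> powr \<delta> * (norm (z - p) powr - \<delta> + norm (z - (p - \<eta>)) powr - \<delta>)))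
     + 4 * norm \<eta> / (pi * R) * (circle_log R + 4 * pi * ln 2 * divisor_count R)"
proof -
  have R0: "0 < R" using R by simp
  obtain R' h where lf: "log_factor R R' h" using log_factor_exists[OF R0 R(2)] by blast
  then have R': "R < R'" and h: "h holomorphic_on ball 0 R'"
    and rep: "\<And>z. z \<in> ball 0 R' - bad \<Longrightarrow>
       ln (norm (f z)) = Re (h z) + (\<Sum>p\<in>divisor R. of_int (zorder f p) * ln (norm (z - p) / R))"
    unfolding log_factor_def by blast+
  note L = log_factor_on_circle(2)[OF lf R0] and pR = log_factor_on_circle(3)[OF lf R0]
    and cont = log_factor_on_circle(4)[OF lf R0]
  let ?l = "\<lambda>p t. ln (norm (of_real R * cis t - p) / R)"
  let ?L = "\<lambda>t. ln (norm (f (of_real R * cis t)))"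
  have contL: "continuous_on {0..2*pi} ?L"
    unfolding L using pR R0
    by (intro continuous_on_add cont continuous_on_sum continuous_on_mult continuous_on_const
        continuous_on_ln_norm_circle) auto
  have i1: "(\<lambda>t. \<bar>?L t\<bar>) integrable_on {0..2*pi}"
    using contL by (intro integrable_continuous_real continuous_on_rabs)
  have i2: "(\<lambda>t. \<bar>?l p t\<bar>) integrable_on {0..2*pi}" if "p \<in> divisor R" for p
    using pR[OF that] R0 by (intro integrable_continuous_real continuous_on_rabs continuous_on_ln_norm_circle)
  have I: "((\<lambda>t. \<bar>?L t\<bar> + (\<Sum>p\<in>divisor R. \<bar>of_int (zorder f p)\<bar> * \<bar>?l p t\<bar>)) has_integral
      circle_log R + (\<Sum>p\<in>divisor R. \<bar>of_int (zorder f p)\<bar> * integral {0..2*pi} (\<lambda>t. \<bar>?l p t\<bar>))) {0..2*pi}"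
    unfolding circle_log_def using i1 i2
    by (intro has_integral_add has_integral_sum has_integral_mult_right integrable_integral) auto
  have "integral {0..2*pi} (\<lambda>t. \<bar>Re (h (of_real R * cis t))\<bar>)
      \<le> circle_log R + (\<Sum>p\<in>divisor R. \<bar>of_int (zorder f p)\<bar> * integral {0..2*pi} (\<lambda>t. \<bar>?l p t\<bar>))"
  proof (rule has_integral_le[OF integrable_integral I])
    show "(\<lambda>t. \<bar>Re (h (of_real R * cis t))\<bar>) integrable_on {0..2*pi}"
      using cont by (intro integrable_continuous_real continuous_on_rabs)
    fix t
    have "\<bar>\<Sum>p\<in>divisor R. of_int (zorder f p) * ?l p t\<bar> \<le> (\<Sum>p\<in>divisor R. \<bar>of_int (zorder f p)\<bar> * \<bar>?l p t\<bar>)"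
      by (rule order_trans[OF sum_abs]) (simp add: abs_mult)
    then show "\<bar>Re (h (of_real R * cis t))\<bar> \<le> \<bar>?L t\<bar> + (\<Sum>p\<in>divisor R. \<bar>of_int (zorder f p)\<bar> * \<bar>?l p t\<bar>)"
      unfolding L by linarith
  qed
  also have "(\<Sum>p\<in>divisor R. \<bar>of_int (zorder f p)\<bar> * integral {0..2*pi} (\<lambda>t. \<bar>?l p t\<bar>))
      \<le> (\<Sum>p\<in>divisor R. \<bar>of_int (zorder f p)\<bar> * (4 * pi * ln 2))"
    using pR R0 by (intro sum_mono mult_left_mono integral_abs_ln_norm_circle) auto
  also have "\<dots> = 4 * pi * ln 2 * divisor_count R"
    by (simp add: divisor_count_def sum_distrib_left mult_ac)
  finally have "4 / (pi * R) * integral {0..2*pi} (\<lambda>t. \<bar>Re (h (of_real R * cis t))\<bar>) * norm \<eta>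
      \<le> 4 / (pi * R) * (circle_log R + 4 * pi * ln 2 * divisor_count R) * norm \<eta>"
    using R0 by (intro mult_right_mono mult_left_mono) auto
  then have hb: "norm (h (z + \<eta>) - h z) \<le> 4 * norm \<eta> / (pi * R) * (circle_log R + 4 * pi * ln 2 * divisor_count R)"
    using diff_bound_circle_Re[OF h R0 R' z(1,2)] by (simp add: mult_ac)
  let ?B = "\<lambda>p. 2 / \<delta> * norm \<eta> powr \<delta> * (norm (z - p) powr - \<delta> + norm (z - (p - \<eta>)) powr - \<delta>)"
  have zb: "z \<in> ball 0 R' - bad" "z + \<eta> \<in> ball 0 R' - bad" using z R' R0 by auto
  have "ln (norm (f (z + \<eta>))) - ln (norm (f z)) = Re (h (z + \<eta>) - h z)
      + (\<Sum>p\<in>divisor R. of_int (zorder f p) * (ln (norm (z + \<eta> - p)) - ln (norm (z - p))))"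
  proof -
    have "ln (norm (z + \<eta> - p) / R) - ln (norm (z - p) / R) = ln (norm (z + \<eta> - p)) - ln (norm (z - p))"
      if "p \<in> divisor R" for p
    proof -
      have "z \<noteq> p" "z + \<eta> \<noteq> p" using that z by (auto simp: divisor_def)
      then show ?thesis using R0 by (simp add: ln_div)
    qed
    then show ?thesis
      unfolding rep[OF zb(1)] rep[OF zb(2)]
      by (simp add: sum_subtractf[symmetric] right_diff_distrib[symmetric])
  qed
  also have "\<bar>\<dots>\<bar> \<le> norm (h (z + \<eta>) - h z)
      + (\<Sum>p\<in>divisor R. \<bar>of_int (zorder f p) * (ln (norm (z + \<eta> - p)) - ln (norm (z - p)))\<bar>)"
    by (intro order_trans[OF abs_triangle_ineq] add_mono abs_Re_le_cmod sum_abs)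
  also have "\<dots> \<le> 4 * norm \<eta> / (pi * R) * (circle_log R + 4 * pi * ln 2 * divisor_count R)
      + (\<Sum>p\<in>divisor R. \<bar>of_int (zorder f p)\<bar> * ?B p)"
  proof (intro add_mono hb sum_mono)
    fix p assume "p \<in> divisor R"
    then have "z \<noteq> p" "z + \<eta> \<noteq> p" using z by (auto simp: divisor_def)
    then show "\<bar>of_int (zorder f p) * (ln (norm (z + \<eta> - p)) - ln (norm (z - p)))\<bar> \<le> \<bar>of_int (zorder f p)\<bar> * ?B p"
      unfolding abs_mult using \<delta> by (intro mult_left_mono abs_ln_shift_le) auto
  qed
  finally show ?thesis by simp
qed

text \<open>The pointwise bound is symmetric under inverting the quotient, so one majorant
  \<open>H\<close> serves both proximity functions. Its singularities sit at the points
  \<open>p\<close> and \<open>p - \<eta>\<close>, and the uniform kernel bound integrates them all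
  alike.\<close>

lemma proximity_shift_bound:
  assumes R: "1 \<le> R" "good_radius R" and \<delta>: "0 < \<delta>" "\<delta> < 1"
    and r: "0 < r" "r + norm \<eta> \<le> R / 2"
    and kernel: "\<And>p. (\<lambda>\<theta>. norm (of_real r * cis \<theta> - p) powr - \<delta>) integrable_on {0..2*pi}"
      "\<And>p. integral {0..2*pi} (\<lambda>\<theta>. norm (of_real r * cis \<theta> - p) powr - \<delta>) \<le> C * r powr - \<delta>"
  shows "proximity r (\<lambda>z. f (z + \<eta>) / f z) + proximity r (\<lambda>z. f z / f (z + \<eta>)) \<le>
     4 * C * norm \<eta> powr \<delta> / (pi * \<delta>) * (divisor_count R * r powr - \<delta>)
     + 8 * norm \<eta> / (pi * R) * (circle_log R + 4 * pi * ln 2 * divisor_count R)"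
proof -
  define K where "K = 4 * norm \<eta> / (pi * R) * (circle_log R + 4 * pi * ln 2 * divisor_count R)"
  define B where "B = 2 / \<delta> * norm \<eta> powr \<delta>"
  define k where "k = (\<lambda>p. integral {0..2*pi} (\<lambda>\<theta>. norm (of_real r * cis \<theta> - p) powr - \<delta>))"
  define H where "H = (\<lambda>t. (\<Sum>p\<in>divisor R. \<bar>of_int (zorder f p)\<bar> *
      (B * (norm (of_real r * cis t - p) powr - \<delta> + norm (of_real r * cis t - (p - \<eta>)) powr - \<delta>))) + K)"
  define I where "I = (\<Sum>p\<in>divisor R. \<bar>of_int (zorder f p)\<bar> * (B * (k p + k (p - \<eta>)))) + 2 * pi * K"
  \<comment> \<open>These are the points of the circle at which \<open>z\<close> or
    \<open>z + \<eta>\<close> may be bad.\<close>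
  define T where "T = divisor r \<union> (\<lambda>z. z - \<eta>) ` divisor (r + norm \<eta>)"
  define E where "E = {t \<in> {0..2*pi}. of_real r * cis t \<in> T}"
  have E: "finite E" unfolding E_def using r by (intro finite_circle_preimage) (auto simp: T_def)
  have K0: "0 \<le> K" and B0: "0 \<le> B"
    using R \<delta> circle_log_nonneg[of R] divisor_count_nonneg[of R] by (auto simp: K_def B_def)
  have k0: "0 \<le> k p" for p
    unfolding k_def using kernel(1) by (intro integral_nonneg) auto
  have I0: "0 \<le> I"
    unfolding I_def using K0 B0 k0 by (intro add_nonneg_nonneg sum_nonneg mult_nonneg_nonneg) auto
  have cK: "((\<lambda>t. K) has_integral 2 * pi * K) {0..2*pi}"
    using has_integral_const_real[of K 0 "2 * pi"] by simp
  have H: "(H has_integral I) {0..2*pi}"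
    unfolding H_def I_def k_def using kernel(1)
    by (intro has_integral_add has_integral_sum has_integral_mult_right integrable_integral cK) auto
  have main: "\<bar>ln (norm (f (of_real r * cis t + \<eta>))) - ln (norm (f (of_real r * cis t)))\<bar> \<le> H t
      \<and> f (of_real r * cis t + \<eta>) \<noteq> 0 \<and> f (of_real r * cis t) \<noteq> 0" if t: "t \<in> {0..2*pi} - E" for t
  proof -
    let ?z = "of_real r * cis t"
    have n: "norm ?z = r" using r by simp
    have n': "norm (?z + \<eta>) \<le> r + norm \<eta>" using norm_triangle_ineq[of ?z \<eta>] n by simp
    have T: "?z \<notin> T" using t by (auto simp: E_def)
    have nb: "?z \<notin> bad" using T n by (auto simp: T_def divisor_def)
    have nb': "?z + \<eta> \<notin> bad"
    proof
      assume "?z + \<eta> \<in> bad"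
      then have "?z + \<eta> \<in> divisor (r + norm \<eta>)" using n' by (simp add: divisor_def)
      then have "?z \<in> T" unfolding T_def by (intro UnI2 image_eqI[of _ _ "?z + \<eta>"]) auto
      then show False using T by simp
    qed
    have "norm ?z \<le> R / 2" "norm (?z + \<eta>) \<le> R / 2" using n n' r norm_ge_zero[of \<eta>] by linarith+
    then show ?thesis
      using log_shift_bound[OF R \<delta>(1) less_imp_le[OF \<delta>(2)] _ _ nb nb'] nb nb'
      by (simp add: H_def B_def K_def bad_def)
  qed
  have lp: "log_plus (norm (a / b)) \<le> \<bar>ln (norm a) - ln (norm b)\<bar>" if "a \<noteq> 0" "b \<noteq> 0" for a b :: complex
    using that by (auto simp: log_plus_eq norm_divide ln_div)
  have q1: "proximity r (\<lambda>z. f (z + \<eta>) / f z) \<le> I / (2 * pi)"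
  proof (intro proximity_le[OF E H I0])
    fix t assume "t \<in> {0..2*pi} - E"
    then show "log_plus (norm (f (of_real r * cis t + \<eta>) / f (of_real r * cis t))) \<le> H t"
      using main[of t] lp[of "f (of_real r * cis t + \<eta>)" "f (of_real r * cis t)"] by auto
  qed
  have q2: "proximity r (\<lambda>z. f z / f (z + \<eta>)) \<le> I / (2 * pi)"
  proof (intro proximity_le[OF E H I0])
    fix t assume "t \<in> {0..2*pi} - E"
    then show "log_plus (norm (f (of_real r * cis t) / f (of_real r * cis t + \<eta>))) \<le> H t"
      using main[of t] lp[of "f (of_real r * cis t)" "f (of_real r * cis t + \<eta>)"] by auto
  qed
  have I_le: "I \<le> 2 * B * C * (divisor_count R * r powr - \<delta>) + 2 * pi * K"
  proof -
    have "(\<Sum>p\<in>divisor R. \<bar>of_int (zorder f p)\<bar> * (B * (k p + k (p - \<eta>))))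
        \<le> (\<Sum>p\<in>divisor R. \<bar>of_int (zorder f p)\<bar> * (B * (C * r powr - \<delta> + C * r powr - \<delta>)))"
      using kernel(2) B0 unfolding k_def by (intro sum_mono mult_left_mono add_mono) auto
    also have "\<dots> = 2 * B * C * (divisor_count R * r powr - \<delta>)"
      by (simp add: divisor_count_def sum_distrib_left sum_distrib_right mult_ac)
    finally show ?thesis by (simp add: I_def)
  qed
  have "proximity r (\<lambda>z. f (z + \<eta>) / f z) + proximity r (\<lambda>z. f z / f (z + \<eta>)) \<le> I / (2 * pi) + I / (2 * pi)"
    by (rule add_mono[OF q1 q2])
  also have "\<dots> = I / pi" by simp
  also have "\<dots> \<le> (2 * B * C * (divisor_count R * r powr - \<delta>) + 2 * pi * K) / pi"
    using I_le by (rule divide_right_mono) simp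
  also have "\<dots> = 2 * B * C / pi * (divisor_count R * r powr - \<delta>) + 2 * K"
    by (simp add: add_divide_distrib)
  also have "2 * B * C / pi = 4 * C * norm \<eta> powr \<delta> / (pi * \<delta>)"
    using \<delta> by (simp add: B_def mult_ac)
  finally show ?thesis by (simp add: K_def)
qed

end

subsection \<open>Growth\<close>

text \<open>A strict upper bound on the limit superior holds eventually. The truncation
  \<open>max 1\<close> inside \<open>log_plus\<close> also yields \<open>1 \<le> r powr s\<close>,
  which later gives \<open>s \<ge> 0\<close> and absorbs additive constants.\<close>

lemma nevanlinna_char_order_bound:
  assumes "meromorphic_order g = ereal \<sigma>" "\<sigma> < s"
  shows "\<forall>\<^sub>F r in at_top. nevanlinna_char r g \<le> r powr s \<and> 1 \<le> r powr s"
proof -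
  have "Limsup at_top (\<lambda>r. ereal (log_plus (nevanlinna_char r g) / ln r)) < ereal s"
    using assms by (simp add: meromorphic_order_def)
  then have "\<forall>\<^sub>F r in at_top. ereal (log_plus (nevanlinna_char r g) / ln r) < ereal s"
    by (rule Limsup_lessD)
  then show ?thesis using eventually_gt_at_top[of 1]
  proof eventually_elim
    case (elim r)
    then have "ln (max 1 (nevanlinna_char r g)) < s * ln r"
      by (simp add: log_plus_def field_simps)
    also have "s * ln r = ln (r powr s)" by simp
    finally have "max 1 (nevanlinna_char r g) < r powr s"
      using elim by (subst (asm) ln_less_cancel_iff) auto
    then show ?case by auto
  qed
qed

context nonzero_meromorphic
begin

text \<open>Two good radii are used: \<open>R\<close> between \<open>4 * r\<close> and
  \<open>5 * r\<close>, and \<open>S\<close> between \<open>10 * r\<close> and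
  \<open>11 * r\<close>. Since \<open>2 * R \<le> S\<close>, the characteristic at \<open>S\<close>
  controls the divisor count at \<open>R\<close>.\<close>

lemma growth_bounds:
  assumes "meromorphic_order f = ereal \<sigma>" "\<sigma> < s"
  obtains A where "0 \<le> A"
    "\<forall>\<^sub>F r in at_top. \<exists>R. 4 * r < R \<and> good_radius R \<and>
       circle_log R \<le> A * r powr s \<and> divisor_count R \<le> A * r powr s"
proof -
  obtain r0 where r0: "\<And>r. r \<ge> r0 \<Longrightarrow> nevanlinna_char r f \<le> r powr s \<and> 1 \<le> r powr s"
    using nevanlinna_char_order_bound[OF assms] by (auto simp: eventually_at_top_linorder)
  define l where "l = \<bar>ln (norm leading_coeff)\<bar>"
  have s: "0 \<le> s"
    using r0[of "max r0 2"] by (cases "s < 0") (auto simp: powr_less_one dest: leD)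
  \<comment> \<open>The factor \<open>11 powr s\<close> pays for evaluating the characteristic at
    radii up to \<open>11 * r\<close>; the first factor adds the constants of the two
    estimates.\<close>
  define A where "A = (4 * pi + 2 / ln 2) * (11 powr s + l)"
  have l: "0 \<le> l" by (simp add: l_def)
  have "0 \<le> A" using l by (auto simp: A_def)
  moreover have "\<forall>\<^sub>F r in at_top. \<exists>R. 4 * r < R \<and> good_radius R \<and>
       circle_log R \<le> A * r powr s \<and> divisor_count R \<le> A * r powr s"
    using eventually_ge_at_top[of "max r0 1"]
  proof eventually_elim
    case (elim r)
    then have r: "r0 \<le> r" "1 \<le> r" by auto
    have 1: "1 \<le> r powr s" using r r0 by auto
    obtain R where R: "4 * r < R" "R < 5 * r" "good_radius R"
      using good_radius_exists[of "4 * r" "5 * r"] r by auto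
    obtain S where S: "10 * r < S" "S < 11 * r" "good_radius S"
      using good_radius_exists[of "10 * r" "11 * r"] r by auto
    have T: "nevanlinna_char x f + l \<le> (11 powr s + l) * r powr s" if "r \<le> x" "x \<le> 11 * r" for x
    proof -
      have "nevanlinna_char x f \<le> x powr s" using r0 r that by auto
      also have "\<dots> \<le> (11 * r) powr s" using that r s by (intro powr_mono2) auto
      also have "\<dots> = 11 powr s * r powr s" using r by (simp add: powr_mult)
      finally have "nevanlinna_char x f \<le> 11 powr s * r powr s" .
      moreover have "l \<le> l * r powr s" using 1 l mult_left_mono[of 1 "r powr s" l] by simp
      ultimately show ?thesis by (simp add: ring_distribs)
    qed
    have X: "0 \<le> (11 powr s + l) * r powr s" using l by simp
    have "circle_log R \<le> 4 * pi * (nevanlinna_char R f + l)"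
      unfolding l_def using R r by (intro characteristic_bounds) auto
    also have "\<dots> \<le> 4 * pi * ((11 powr s + l) * r powr s)"
      using R r by (intro mult_left_mono T) auto
    also have "\<dots> \<le> (4 * pi + 2 / ln 2) * ((11 powr s + l) * r powr s)"
      using X by (intro mult_right_mono) auto
    finally have c: "circle_log R \<le> A * r powr s" by (simp add: A_def mult_ac)
    have "ln 2 * divisor_count R \<le> (\<Sum>p\<in>divisor S. \<bar>of_int (zorder f p)\<bar> * height S p)"
      using R S r by (intro divisor_count_le) auto
    also have "\<dots> \<le> 2 * (nevanlinna_char S f + l)"
      unfolding l_def using S r by (intro characteristic_bounds) auto
    also have "\<dots> \<le> 2 * ((11 powr s + l) * r powr s)"
      using S r by (intro mult_left_mono T) auto
    finally have "divisor_count R \<le> 2 / ln 2 * ((11 powr s + l) * r powr s)"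
      by (simp add: field_simps)
    also have "\<dots> \<le> (4 * pi + 2 / ln 2) * ((11 powr s + l) * r powr s)"
      using X by (intro mult_right_mono) auto
    finally have "divisor_count R \<le> A * r powr s" by (simp add: A_def mult_ac)
    then show ?case using R c by blast
  qed
  ultimately show thesis by (rule that)
qed

lemma proximity_shift_bigo:
  assumes ord: "meromorphic_order f = ereal \<sigma>" and eps: "\<epsilon> > 0"
  shows "(\<lambda>r. proximity r (\<lambda>z. f (z + \<eta>) / f z) + proximity r (\<lambda>z. f z / f (z + \<eta>)))
           \<in> O[at_top](\<lambda>r. r powr (\<sigma> - 1 + \<epsilon>))"
proof -
  \<comment> \<open>Half of \<epsilon> is spent on \<open>1 - \<delta>\<close> and half on
    \<open>s - \<sigma>\<close>, so \<open>s - \<delta> \<le> \<sigma> - 1 + \<epsilon>\<close>. The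
    maximum with \<open>1 / 2\<close> keeps \<delta> positive when \<epsilon> is large.\<close>
  define \<delta> where "\<delta> = max (1 / 2) (1 - \<epsilon> / 2)"
  have \<delta>: "0 < \<delta>" "\<delta> < 1" "1 - \<epsilon> / 2 \<le> \<delta>" using eps by (auto simp: \<delta>_def)
  define s where "s = \<sigma> + \<epsilon> / 2"
  have s: "\<sigma> < s" using eps by (simp add: s_def)
  obtain C where C: "C > 0"
    "\<And>r p. r > 0 \<Longrightarrow> (\<lambda>\<theta>. norm (of_real r * cis \<theta> - p) powr - \<delta>) integrable_on {0..2*pi}"
    "\<And>r p. r > 0 \<Longrightarrow> integral {0..2*pi} (\<lambda>\<theta>. norm (of_real r * cis \<theta> - p) powr - \<delta>) \<le> C * r powr - \<delta>"
    using circle_kernel[OF \<delta>(1,2)] by blast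
  obtain A where A: "0 \<le> A" "\<forall>\<^sub>F r in at_top. \<exists>R. 4 * r < R \<and> good_radius R \<and>
       circle_log R \<le> A * r powr s \<and> divisor_count R \<le> A * r powr s"
    using growth_bounds[OF ord s] by blast
  define a where "a = 4 * C * norm \<eta> powr \<delta> / (pi * \<delta>)"
  \<comment> \<open>The 2 is 8 divided by 4, because \<open>R > 4 * r\<close>.\<close>
  define b where "b = 2 * norm \<eta> / pi * (A + 4 * pi * ln 2 * A)"
  have a: "0 \<le> a" using C(1) \<delta> by (simp add: a_def)
  have b: "0 \<le> b" using A(1) by (simp add: b_def)
  show ?thesis
  proof (rule bigoI)
    show "\<forall>\<^sub>F r in at_top. norm (proximity r (\<lambda>z. f (z + \<eta>) / f z) + proximity r (\<lambda>z. f z / f (z + \<eta>)))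
        \<le> (a * A + b) * norm (r powr (\<sigma> - 1 + \<epsilon>))"
      \<comment> \<open>From \<open>norm \<eta> \<le> r\<close> it follows that
        \<open>r + norm \<eta> \<le> 2 * r\<close>, which is below \<open>R / 2\<close>.\<close>
      using A(2) eventually_ge_at_top[of "max 1 (norm \<eta>)"]
    proof eventually_elim
      case (elim r)
      then obtain R where R: "4 * r < R" "good_radius R"
        and cR: "circle_log R \<le> A * r powr s" and nR: "divisor_count R \<le> A * r powr s" by blast
      have r: "1 \<le> r" "norm \<eta> \<le> r" using elim by auto
      have "proximity r (\<lambda>z. f (z + \<eta>) / f z) + proximity r (\<lambda>z. f z / f (z + \<eta>))
          \<le> a * (divisor_count R * r powr - \<delta>)
            + 8 * norm \<eta> / (pi * R) * (circle_log R + 4 * pi * ln 2 * divisor_count R)"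
        unfolding a_def using R r \<delta> C by (intro proximity_shift_bound) auto
      also have "\<dots> \<le> a * (A * r powr s * r powr - \<delta>)
            + 8 * norm \<eta> / (pi * (4 * r)) * (A * r powr s + 4 * pi * ln 2 * (A * r powr s))"
        using R r a cR nR A(1) circle_log_nonneg[of R] divisor_count_nonneg[of R]
        by (intro add_mono mult_left_mono mult_mono mult_right_mono divisor_count_nonneg
            divide_left_mono mult_pos_pos) auto
      also have "\<dots> = a * A * r powr (s - \<delta>) + b * r powr (s - 1)"
        using r by (simp add: b_def powr_diff powr_minus field_simps)
      also have "\<dots> \<le> a * A * r powr (\<sigma> - 1 + \<epsilon>) + b * r powr (\<sigma> - 1 + \<epsilon>)"
        using r a b A(1) \<delta> eps by (intro add_mono mult_left_mono powr_mono) (auto simp: s_def)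
      finally show ?case
        using proximity_nonneg[of r "\<lambda>z. f (z + \<eta>) / f z"] proximity_nonneg[of r "\<lambda>z. f z / f (z + \<eta>)"]
        by (simp add: ring_distribs)
    qed
  qed
qed

end

theorem corollary2p5:
  fixes f :: "complex \<Rightarrow> complex" and \<sigma> \<epsilon> :: real and \<eta> :: complex
  assumes "f meromorphic_on UNIV"
    and "\<not> (\<forall>\<^sub>\<approx>z\<in>UNIV. f z = 0)"
    and "meromorphic_order f = ereal \<sigma>"
    and "\<eta> \<noteq> 0"
    and "\<epsilon> > 0"
  shows "(\<lambda>r. proximity r (\<lambda>z. f (z + \<eta>) / f z) + proximity r (\<lambda>z. f z / f (z + \<eta>)))
           \<in> O[at_top](\<lambda>r. r powr (\<sigma> - 1 + \<epsilon>))"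
proof -
  interpret nonzero_meromorphic f by standard (fact assms)+
  show ?thesis using assms by (intro proximity_shift_bigo)
qed

end
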